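(* Let $(X,\mu)$ be a nonatomic probability space equipped with a tree $\mathcal{T}$. Let $f,F_1,\dots,F_m>0$ and $p_1,\dots,p_m>1$ be real numbers with $$f\le \min\left\{\left(\frac{p_j}{p_j-1}F_j\right)^{1/p_j}:\ 1\le j\le m\right\}.$$ Let $G:[0,+\infty)\to[0,+\infty)$ be any non-decreasing function, let $h:(0,1]\to\mathbb{R}^+$ be any locally integrable function, and let $k\in(0,1]$. Define the Bellman type function $$\mathcal{B}^{\mathcal{T}}_{G,h,p_1,\dots,p_m}(F_1,\dots,F_m,f,k)=\sup\left\{\int_0^k G\big[(M_{\mathcal{T}}\phi)^*(t)\big]h(t)\,dt:\ \phi\ge 0\text{ measurable on }X\text{ with }\|\phi\|_{1}=f,\ \|\phi\|_{p_1,\infty}^{p_1}\le F_1,\dots,\|\phi\|_{p_m,\infty}^{p_m}\le F_m\right\}.$$ Then $$\mathcal{B}^{\mathcal{T}}_{G,h,p_1,\dots,p_m}(F_1,\dots,F_m,f,k)=\int_0^k G\left(\frac1t\int_0^{\min(t,\sigma)}\min_{1\le j\le m}\left(\frac{F_j}{u}\right)^{1/p_j}du\right)h(t)\,dt,$$ where $\sigma$ is defined by the equality $$\int_0^{\sigma}\min_{1\le j\le m}\left(\frac{F_j}{u}\right)^{1/p_j}du=f .$$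
   Context: Let $(X,\mu)$ be a nonatomic probability space. Two measurable sets $A,B\subseteq X$ are almost disjoint if $\mu(A\cap B)=0$. A set $\mathcal{T}$ of measurable subsets of $X$ is called a tree if: (i) $X\in\mathcal{T}$ and $\mu(I)>0$ for every $I\in\mathcal{T}$; (ii) for every $I\in\mathcal{T}$ there corresponds a finite subset $\mathcal{C}(I)\subseteq\mathcal{T}$ with at least two elements, whose elements are pairwise almost disjoint subsets of $I$ and such that $I=\bigcup\mathcal{C}(I)$; (iii) $\mathcal{T}=\bigcup_{n\ge0}\mathcal{T}_{(n)}$, where $\mathcal{T}_{(0)}=\{X\}$ and $\mathcal{T}_{(n+1)}=\bigcup_{I\in\mathcal{T}_{(n)}}\mathcal{C}(I)$; (iv) $\lim_{n\to\infty}\sup_{I\in\mathcal{T}_{(n)}}\mu(I)=0$. The associated maximal operator is $M_{\mathcal{T}}\phi(x)=\sup\{\frac1{\mu(I)}\int_I|\phi|\,d\mu: x\in I\in\mathcal{T}\}$ for $\phi\in L^1(X,\mu)$. For measurable $\phi$ on $X$, $\phi^*$ denotes the equimeasurable decreasing rearrangement of $\phi$, defined on $(0,1]$. $\|\phi\|_1$ is the norm of $L^1(X,\mu)$, and for $p>1$, $\|\phi\|_{p,\infty}=\sup_{0<t\le1}t^{1/p}\phi^*(t)$ is the weak $L^p$ quasinorm; thus, for $\phi\ge0$, $\|\phi\|_{p,\infty}^p\le F$ means $\phi^*(t)\le(F/t)^{1/p}$ for all $t\in(0,1]$.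
   Formalization: For m ≥ 2 the formula is proved under the extra condition σ ≤ 1, which the stated bound on f does not imply; when σ > 1 no φ satisfies the constraints, so the supremum is over the empty set and the printed formula fails. *)

theory Defs
  imports "HOL-Analysis.Analysis" "HOL-Probability.Probability_Measure"
begin

definition nonatomic :: "'a measure \<Rightarrow> bool" where
  "nonatomic M \<longleftrightarrow>
     (\<forall>A\<in>sets M. 0 < emeasure M A \<longrightarrow>
        (\<exists>B\<in>sets M. B \<subseteq> A \<and> 0 < emeasure M B \<and> emeasure M B < emeasure M A))"

primrec tree_level :: "('a set \<Rightarrow> 'a set set) \<Rightarrow> 'a set \<Rightarrow> nat \<Rightarrow> 'a set set" where
  "tree_level C X 0 = {X}"
| "tree_level C X (Suc n) = (\<Union>I\<in>tree_level C X n. C I)"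

text \<open>The children map is existentially quantified: the maximal operator depends only on the
  family of sets.\<close>

definition is_tree :: "'a measure \<Rightarrow> 'a set set \<Rightarrow> bool" where
  "is_tree M T \<longleftrightarrow>
     T \<subseteq> sets M \<and> space M \<in> T \<and> (\<forall>I\<in>T. 0 < emeasure M I) \<and>
     (\<exists>C. (\<forall>I\<in>T. C I \<subseteq> T \<and> finite (C I) \<and> 2 \<le> card (C I) \<and>
                (\<forall>J\<in>C I. J \<subseteq> I) \<and>
                pairwise (\<lambda>A B. emeasure M (A \<inter> B) = 0) (C I) \<and>
                I = \<Union>(C I)) \<and>
          T = (\<Union>n. tree_level C (space M) n) \<and>
          (\<lambda>n. SUP I\<in>tree_level C (space M) n. emeasure M I) \<longlonglongrightarrow> 0)"

definition maximal_op :: "'a measure \<Rightarrow> 'a set set \<Rightarrow> ('a \<Rightarrow> real) \<Rightarrow> 'a \<Rightarrow> ennreal" where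
  "maximal_op M T \<phi> x =
     (SUP I\<in>{I\<in>T. x \<in> I}. (\<integral>\<^sup>+y\<in>I. ennreal \<bar>\<phi> y\<bar> \<partial>M) / emeasure M I)"

text \<open>The strict inequality \<open>< t\<close> selects the left-continuous version of the rearrangement, so that
  the value at the right end point \<open>t = 1\<close> of a probability space is the essential infimum (with
  \<open>\<le> t\<close> it would always be \<open>0\<close>). The argument is \<open>ennreal\<close>-valued because a maximal function may
  be infinite on a null set; for a real function \<open>\<phi>\<close> one uses \<open>\<bar>\<phi>\<bar>\<close>.\<close>

definition decr_rearr :: "'a measure \<Rightarrow> ('a \<Rightarrow> ennreal) \<Rightarrow> real \<Rightarrow> ennreal" where
  "decr_rearr M g t = Inf {s. emeasure M {x\<in>space M. s < g x} < ennreal t}"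

definition weak_norm :: "'a measure \<Rightarrow> real \<Rightarrow> ('a \<Rightarrow> real) \<Rightarrow> ennreal" where
  "weak_norm M p \<phi> =
     (SUP t\<in>{0<..1}. ennreal (t powr (1 / p)) * decr_rearr M (\<lambda>x. ennreal \<bar>\<phi> x\<bar>) t)"

definition admissible ::
    "'a measure \<Rightarrow> nat \<Rightarrow> (nat \<Rightarrow> real) \<Rightarrow> (nat \<Rightarrow> real) \<Rightarrow> real \<Rightarrow> ('a \<Rightarrow> real) set" where
  "admissible M m p F f =
     {\<phi>. \<phi> \<in> borel_measurable M \<and> (\<forall>x\<in>space M. 0 \<le> \<phi> x) \<and>
          integrable M \<phi> \<and> (\<integral>x. \<bar>\<phi> x\<bar> \<partial>M) = f \<and>
          (\<forall>j\<in>{1..m}. weak_norm M (p j) \<phi> < \<infinity> \<and>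
                       enn2real (weak_norm M (p j) \<phi>) powr p j \<le> F j)}"

text \<open>For integrable \<open>\<phi>\<close> on a probability space the rearranged maximal function is finite at every
  \<open>t > 0\<close> by the weak type \<open>(1, 1)\<close> inequality, so \<open>enn2real\<close> only changes the type. The outer
  integral may be infinite and is taken in \<open>[0, \<infinity>]\<close>.\<close>

definition bellman ::
    "'a measure \<Rightarrow> 'a set set \<Rightarrow> (real \<Rightarrow> real) \<Rightarrow> (real \<Rightarrow> real) \<Rightarrow> nat \<Rightarrow> (nat \<Rightarrow> real) \<Rightarrow>
     (nat \<Rightarrow> real) \<Rightarrow> real \<Rightarrow> real \<Rightarrow> ennreal" where
  "bellman M T G h m p F f k =
     (SUP \<phi>\<in>admissible M m p F f.
        \<integral>\<^sup>+t\<in>{0<..k}. ennreal (G (enn2real (decr_rearr M (maximal_op M T \<phi>) t)) * h t) \<partial>lebesgue)"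

definition locally_integrable_01 :: "(real \<Rightarrow> real) \<Rightarrow> bool" where
  "locally_integrable_01 h \<longleftrightarrow>
     (\<forall>K. compact K \<and> K \<subseteq> {0<..1} \<longrightarrow> set_integrable lebesgue K h)"

definition weak_envelope :: "nat \<Rightarrow> (nat \<Rightarrow> real) \<Rightarrow> (nat \<Rightarrow> real) \<Rightarrow> real \<Rightarrow> real" where
  "weak_envelope m p F u = (MIN j\<in>{1..m}. (F j / u) powr (1 / p j))"

definition envelope_integral :: "nat \<Rightarrow> (nat \<Rightarrow> real) \<Rightarrow> (nat \<Rightarrow> real) \<Rightarrow> real \<Rightarrow> real" where
  "envelope_integral m p F s = (LINT u:{0<..s}|lebesgue. weak_envelope m p F u)"

end

theory Submission
  imports Defs "HOL-Probability.Probability"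
begin

text \<open>Let \<open>w\<close> be the envelope and \<open>A(t)\<close> the average over \<open>(0, t]\<close> of \<open>w\<close> cut off at \<open>\<sigma>\<close>.
  The weak bounds together with the prescribed integral give \<open>\<integral>\<^sub>E \<phi> \<le> \<tau> A(\<tau>)\<close> for every set \<open>E\<close>
  of measure \<open>\<tau>\<close>, so the weak type \<open>(1,1)\<close> inequality of the maximal operator yields
  \<open>(M \<phi>)\<^sup>*(t) \<le> A(t)\<close>.

  Conversely, fix \<open>r < 1\<close>. There is a uniform variable \<open>V\<close> on the space such that for each
  \<open>j \<le> N\<close> the tree sets on which \<open>V\<close> is uniform on \<open>(0, r\<^sup>j]\<close> cover measure at least \<open>r\<^sup>j\<close>.
  The function \<open>\<phi> = w(V)\<close>, cut off at \<open>V \<le> \<sigma>\<close>, is admissible and has average \<open>A(r\<^sup>j)\<close> over each of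
  these sets, so \<open>(M \<phi>)\<^sup>*(t) \<ge> A(t/r)\<close> for \<open>r\<^sup>N < t\<close>. Since \<open>G \<circ> A\<close> is monotone, it has only
  countably many discontinuities, and Fatou's lemma gives the lower bound as \<open>r \<rightarrow> 1\<close>.\<close>

section \<open>Subfamilies of a tree with prescribed measure\<close>

text \<open>The maximal operator averages only over tree sets, and a single tree set need not have
  measure close to a given t. A family of tree sets serves as well: if \<open>V\<close> is uniform
  on (0, b] on each member, every member has the average A(b), and only the union has to have
  measure at least b. Families filling an exact measure exist because an unfilled remainder can be
  pushed into ever deeper levels, whose sets shrink. Only the scales b = \<open>r ^ j\<close> are
  prepared, which costs the shift from t to t/r; finitely many of them suffice because small t are
  dropped before the limit.

  Siblings in the tree may overlap in null sets. Gluing of functions, sums of integrals and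
  coverings therefore all work off a null set of pairwise overlaps.

  The condition \<sigma> <= 1 enters through the extremal function: a variable uniform on (0, 1]
  sees the whole mass f of the cut-off envelope only if the cut-off lies in (0, 1].\<close>

lemma (in finite_measure) measure_eq_if_null_diff:
  assumes "A \<in> sets M" "B \<in> sets M" "N \<in> null_sets M" "A - N = B - N"
  shows "measure M A = measure M B"
proof (rule measure_eq_AE)
  show "AE x in M. x \<in> A \<longleftrightarrow> x \<in> B"
    using AE_not_in[OF assms(3)] by eventually_elim (use assms(4) in blast)
qed (use assms in auto)

lemma (in finite_measure) measure_Un_null_Int:
  assumes "A \<in> sets M" "B \<in> sets M" "A \<inter> B \<in> null_sets M"
  shows "measure M (A \<union> B) = measure M A + measure M B"
proof (rule measure_Un_AE)
  show "AE x in M. x \<notin> A \<or> x \<notin> B"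
    using AE_not_in[OF assms(3)] by eventually_elim blast
qed (use assms in \<open>auto simp: fmeasurable_eq_sets\<close>)

text \<open>One witness \<open>C\<close> of the existential children map in \<open>is_tree\<close>
  is fixed, so that levels and descents can be spoken of. Overlaps are stated as null sets, which
  carry measurability along.\<close>

locale measure_tree = prob_space M
  for M :: "'a measure" and T :: "'a set set" and C :: "'a set \<Rightarrow> 'a set set" +
  assumes tree_sets: "T \<subseteq> sets M"
    and root_in_tree: "space M \<in> T"
    and tree_pos: "\<And>I. I \<in> T \<Longrightarrow> 0 < prob I"
    and children_subset: "\<And>I. I \<in> T \<Longrightarrow> C I \<subseteq> T"
    and finite_children: "\<And>I. I \<in> T \<Longrightarrow> finite (C I)"
    and children_null_Int:
      "\<And>I. I \<in> T \<Longrightarrow> pairwise (\<lambda>A B. A \<inter> B \<in> null_sets M) (C I)"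
    and Union_children: "\<And>I. I \<in> T \<Longrightarrow> \<Union>(C I) = I"
    and tree_levels: "T = (\<Union>n. tree_level C (space M) n)"
    and level_measure_tendsto:
      "(\<lambda>n. SUP I\<in>tree_level C (space M) n. emeasure M I) \<longlonglongrightarrow> 0"
begin

lemma sets_tree [measurable_dest]: "I \<in> T \<Longrightarrow> I \<in> sets M"
  using tree_sets by auto

lemma children_le: "I \<in> T \<Longrightarrow> J \<in> C I \<Longrightarrow> J \<subseteq> I"
  using Union_children by blast

lemma children_in_tree: "I \<in> T \<Longrightarrow> J \<in> C I \<Longrightarrow> J \<in> T"
  using children_subset by blast

lemma level_in_tree: "I \<in> tree_level C (space M) n \<Longrightarrow> I \<in> T"
  using tree_levels by blast

lemma finite_level: "finite (tree_level C (space M) n)"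
proof (induction n)
  case (Suc n)
  then show ?case using finite_children level_in_tree by auto
qed simp

lemma Union_level: "\<Union>(tree_level C (space M) n) = space M"
proof (induction n)
  case (Suc n)
  have "\<Union>(tree_level C (space M) (Suc n)) = (\<Union>I\<in>tree_level C (space M) n. \<Union>(C I))"
    by auto
  also have "\<dots> = \<Union>(tree_level C (space M) n)"
    using Union_children level_in_tree by auto
  finally show ?case using Suc by simp
qed simp

lemma countable_tree: "countable T"
  unfolding tree_levels using finite_level by (intro countable_UN) (auto intro: countable_finite)

lemma level_measure_small:
  assumes "0 < e"
  shows "eventually (\<lambda>n. \<forall>I\<in>tree_level C (space M) n. prob I < e) sequentially"
proof -
  have "eventually (\<lambda>n. (SUP I\<in>tree_level C (space M) n. emeasure M I) < ennreal e) sequentially"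
    using order_tendstoD(2)[OF level_measure_tendsto, of "ennreal e"] assms by simp
  then show ?thesis
  proof eventually_elim
    case (elim n)
    show ?case
    proof
      fix I assume "I \<in> tree_level C (space M) n"
      then have "emeasure M I < ennreal e"
        using elim by (meson SUP_upper le_less_trans)
      then show "prob I < e" by (simp add: emeasure_eq_measure ennreal_less_iff)
    qed
  qed
qed

lemma Union_sets [intro]: "F \<subseteq> T \<Longrightarrow> \<Union>F \<in> sets M"
  by (meson countable_subset countable_tree sets.countable_Union subset_trans tree_sets)

text \<open>Among the finitely many sets of children whose union has measure at most
  \<open>c\<close>, take one of largest measure. It omits some child because
  \<open>c < prob I\<close>, and adding an omitted child, which has positive measure, must overshoot
  \<open>c\<close>. So the remainder fits strictly into that child.\<close>

lemma greedy_children: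
  assumes I: "I \<in> T" and c: "0 \<le> c" "c < prob I"
  shows "\<exists>G J. G \<subseteq> C I \<and> J \<in> C I \<and> J \<notin> G \<and> prob (\<Union>G) \<le> c \<and> c - prob (\<Union>G) < prob J"
proof -
  define S where "S = {G. G \<subseteq> C I \<and> prob (\<Union>G) \<le> c}"
  have fin: "finite S"
    unfolding S_def using finite_children[OF I] by auto
  have "{} \<in> S" using c by (auto simp: S_def)
  then have "Max ((\<lambda>G. prob (\<Union>G)) ` S) \<in> (\<lambda>G. prob (\<Union>G)) ` S"
    using fin by (intro Max_in) auto
  then obtain G where G: "G \<in> S" and max: "\<And>G'. G' \<in> S \<Longrightarrow> prob (\<Union>G') \<le> prob (\<Union>G)"
    using fin by (metis (no_types, lifting) Max_ge finite_imageI image_eqI imageE)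
  have "G \<noteq> C I" using G c Union_children[OF I] by (auto simp: S_def)
  then obtain J where J: "J \<in> C I" "J \<notin> G" using G by (auto simp: S_def)
  have sub: "G \<subseteq> T" "J \<in> T" using G J children_subset[OF I] by (auto simp: S_def)
  have "J \<inter> \<Union>G = (\<Union>K\<in>G. J \<inter> K)" by auto
  also have "\<dots> \<in> null_sets M"
  proof (rule null_sets_UN')
    show "countable G" using countable_subset sub(1) countable_tree by blast
    show "\<And>K. K \<in> G \<Longrightarrow> J \<inter> K \<in> null_sets M"
      using J G by (intro pairwiseD[OF children_null_Int[OF I]]) (auto simp: S_def)
  qed
  finally have "prob (J \<union> \<Union>G) = prob J + prob (\<Union>G)"
    using sub by (intro measure_Un_null_Int) (auto simp: sets_tree)
  moreover have "\<not> prob (J \<union> \<Union>G) \<le> c"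
  proof
    assume "prob (J \<union> \<Union>G) \<le> c"
    then have "insert J G \<in> S" using J G by (auto simp: S_def)
    then have "prob (J \<union> \<Union>G) \<le> prob (\<Union>G)" using max[of "insert J G"] by simp
    with calculation tree_pos[OF sub(2)] show False by simp
  qed
  ultimately show ?thesis using G J by (auto simp: S_def intro!: exI[of _ G] exI[of _ J])
qed

text \<open>The greedy choice of children leaves one partially filled child, to which it is applied
  again; the measures of these children tend to zero.\<close>

lemma exact_subfamily:
  assumes I: "I \<in> T" and c: "0 \<le> c" "c < prob I"
  shows "\<exists>F\<subseteq>T. (\<forall>J\<in>F. J \<subseteq> I) \<and> pairwise (\<lambda>A B. A \<inter> B \<in> null_sets M) F \<and> prob (\<Union>F) = c"
proof -
  obtain k where k: "I \<in> tree_level C (space M) k" using I tree_levels by blast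
  \<comment> \<open>A state is a pair of the current tree set and the measure still to be filled
    inside it. The strict bound keeps \<open>greedy_children\<close> applicable; the clause for
    \<open>n = 0\<close> pins the starting state, which the choice principle would leave
    open.\<close>
  define P where "P n x \<longleftrightarrow> fst x \<in> tree_level C (space M) (k + n) \<and> 0 \<le> snd x
    \<and> snd x < prob (fst x) \<and> fst x \<subseteq> I \<and> (n = 0 \<longrightarrow> x = (I, c))" for n and x :: "'a set \<times> real"
  define Q where "Q x y \<longleftrightarrow> (\<exists>G. G \<subseteq> C (fst x) \<and> fst y \<in> C (fst x) \<and> fst y \<notin> G
    \<and> snd y = snd x - prob (\<Union>G))" for x y :: "'a set \<times> real"
  have "\<exists>s. \<forall>n. P n (s n) \<and> Q (s n) (s (Suc n))"
  proof (rule dependent_nat_choice)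
    show "\<exists>x. P 0 x" using k c by (auto simp: P_def)
    fix x n assume x: "P n x"
    have xT: "fst x \<in> T" using x level_in_tree by (auto simp: P_def)
    obtain G J where GJ: "G \<subseteq> C (fst x)" "J \<in> C (fst x)" "J \<notin> G" "prob (\<Union>G) \<le> snd x"
      "snd x - prob (\<Union>G) < prob J"
      using greedy_children[OF xT, of "snd x"] x unfolding P_def by blast
    have "P (Suc n) (J, snd x - prob (\<Union>G))" "Q x (J, snd x - prob (\<Union>G))"
      using x GJ children_le[OF xT] by (auto simp: P_def Q_def)
    then show "\<exists>y. P (Suc n) y \<and> Q x y" by blast
  qed
  then obtain s where P: "\<And>n. P n (s n)" and Q: "\<And>n. Q (s n) (s (Suc n))" by blast
  define J where "J n = fst (s n)" for n
  define d where "d n = snd (s n)" for n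
  have J: "J n \<in> tree_level C (space M) (k + n)" "0 \<le> d n" "d n < prob (J n)" "J n \<subseteq> I" for n
    using P[of n] by (auto simp: P_def J_def d_def)
  have d0: "d 0 = c" using P[of 0] by (auto simp: P_def d_def)
  have JT: "J n \<in> T" for n using J level_in_tree by blast
  obtain G where G: "\<And>n. G n \<subseteq> C (J n)" "\<And>n. J (Suc n) \<in> C (J n)" "\<And>n. J (Suc n) \<notin> G n"
    "\<And>n. d (Suc n) = d n - prob (\<Union>(G n))"
    using Q unfolding Q_def J_def d_def by metis
  have GT: "G n \<subseteq> T" for n using G(1) children_subset[OF JT] by blast
  have GJ: "\<Union>(G n) \<subseteq> J n" for n using G(1) children_le[OF JT] by blast
  have dec: "J n \<subseteq> J m" if "m \<le> n" for m n
    by (rule lift_Suc_antimono_le[of J, OF _ that]) (use children_le[OF JT G(2)] in auto)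
  have null1: "A \<inter> J (Suc n) \<in> null_sets M" if "A \<in> G n" for A n
    using that G by (intro pairwiseD[OF children_null_Int[OF JT]]) auto
  \<comment> \<open>All later choices lie in \<open>J (Suc n)\<close>, the child omitted at stage n,
    which meets the children chosen at stage n only in null sets.\<close>
  have null_later: "A \<inter> B \<in> null_sets M" if "A \<in> G n" "B \<subseteq> J m" "n < m" "B \<in> sets M" for A B m n
  proof (rule null_sets_subset[OF null1[OF that(1)]])
    show "A \<inter> B \<in> sets M" using GT that sets_tree by blast
    show "A \<inter> B \<subseteq> A \<inter> J (Suc n)" using that dec[of "Suc n" m] by auto
  qed
  define F where "F = (\<Union>n. G n)"
  have FT: "F \<subseteq> T" using GT by (auto simp: F_def)
  have pw: "A \<inter> B \<in> null_sets M" if A: "A \<in> G n" and B: "B \<in> G m" and "A \<noteq> B" for A B m n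
  proof (rule linorder_cases[of n m])
    assume "n = m" then show ?thesis
      using that G(1) by (intro pairwiseD[OF children_null_Int[OF JT]]) auto
  next
    assume "n < m"
    then show ?thesis using null_later[OF A, of B m] GJ[of m] B GT sets_tree by blast
  next
    assume "m < n"
    then have "B \<inter> A \<in> null_sets M"
      using null_later[OF B, of A n] GJ[of n] A GT sets_tree by blast
    then show ?thesis by (simp add: Int_commute)
  qed
  define H where "H n = (\<Union>i<n. \<Union>(G i))" for n
  have H_eq: "H n = \<Union>(\<Union>i<n. G i)" for n by (auto simp: H_def)
  have H_sets: "H n \<in> sets M" for n unfolding H_eq using GT by (intro Union_sets) auto
  \<comment> \<open>The chosen pieces telescope: \<open>d n\<close> is exactly what the first n
    stages leave unfilled.\<close>
  have H_measure: "prob (H n) = c - d n" for n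
  proof (induction n)
    case 0 then show ?case by (simp add: H_def d0)
  next
    case (Suc n)
    have "H n \<inter> \<Union>(G n) = (\<Union>A\<in>(\<Union>i<n. G i). A \<inter> \<Union>(G n))" by (auto simp: H_def)
    also have "\<dots> \<in> null_sets M"
    proof (rule null_sets_UN')
      show "countable (\<Union>i<n. G i)"
        by (rule countable_subset[OF _ countable_tree]) (use GT in auto)
      show "\<And>A. A \<in> (\<Union>i<n. G i) \<Longrightarrow> A \<inter> \<Union>(G n) \<in> null_sets M"
        using null_later[OF _ GJ] GT Union_sets by blast
    qed
    finally have "prob (H n \<union> \<Union>(G n)) = prob (H n) + prob (\<Union>(G n))"
      using GT H_sets by (intro measure_Un_null_Int) auto
    moreover have "H (Suc n) = H n \<union> \<Union>(G n)" by (auto simp: H_def lessThan_Suc)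
    ultimately show ?case using Suc G(4)[of n] by simp
  qed
  have "d \<longlonglongrightarrow> 0"
  proof (rule LIMSEQ_I)
    fix e :: real assume "0 < e"
    obtain N where N: "\<And>n I. n \<ge> N \<Longrightarrow> I \<in> tree_level C (space M) n \<Longrightarrow> prob I < e"
      using level_measure_small[OF \<open>0 < e\<close>] unfolding eventually_sequentially by blast
    have "norm (d n - 0) < e" if "n \<ge> N" for n
      using N[OF _ J(1)[of n]] J(2,3)[of n] that by auto
    then show "\<exists>N. \<forall>n\<ge>N. norm (d n - 0) < e" by blast
  qed
  then have "(\<lambda>n. prob (H n)) \<longlonglongrightarrow> c"
    unfolding H_measure using tendsto_diff[OF tendsto_const, of d 0 sequentially c] by simp
  moreover have "(\<lambda>n. prob (H n)) \<longlonglongrightarrow> prob (\<Union>n. H n)"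
    using H_sets by (intro finite_Lim_measure_incseq) (fastforce simp: incseq_def H_def)+
  moreover have "(\<Union>n. H n) = \<Union>F" by (auto simp: H_def F_def)
  ultimately have "prob (\<Union>F) = c" using LIMSEQ_unique by metis
  moreover have "\<forall>A\<in>F. A \<subseteq> I"
    using GJ J(4) by (fastforce simp: F_def)
  ultimately show ?thesis using FT pw by (intro exI[of _ F]) (auto simp: F_def pairwise_def)
qed

end

section \<open>Uniform variables\<close>

text \<open>At the first differing digit n the sums differ by 3^-n, while all later digits together
  contribute at most half of that. In base 2 the tail could compensate the difference, hence base 3.
  This encodes by one real number which tree sets contain a point.\<close>

lemma ternary_expansion_inj:
  fixes a b :: "nat \<Rightarrow> bool"
  assumes eq: "(\<Sum>n. (1/3::real) ^ n * of_bool (a n)) = (\<Sum>n. (1/3) ^ n * of_bool (b n))"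
  shows "a = b"
proof (rule ccontr)
  assume "a \<noteq> b"
  then have "\<exists>n. a n \<noteq> b n" by auto
  then obtain n where n: "a n \<noteq> b n" and less: "\<And>k. k < n \<Longrightarrow> a k = b k"
    using exists_least_iff[of "\<lambda>n. a n \<noteq> b n"] by blast
  define d where "d k = (of_bool (a k) - of_bool (b k) :: real)" for k
  have d: "\<bar>d k\<bar> \<le> 1" for k by (simp add: d_def)
  have geo: "summable (\<lambda>k. (1/3::real) ^ k)" by simp
  have sa: "summable (\<lambda>k. (1/3::real) ^ k * of_bool (c k))" for c :: "nat \<Rightarrow> bool"
    by (rule summable_comparison_test'[OF geo, of 0]) auto
  have sd: "summable (\<lambda>k. (1/3::real) ^ k * d k)"
    using summable_diff[OF sa[of a] sa[of b]] by (simp add: d_def algebra_simps)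
  have "0 = (\<Sum>k. (1/3) ^ k * d k)"
    using suminf_diff[OF sa[of a] sa[of b]] eq by (simp add: d_def algebra_simps)
  also have "\<dots> = (\<Sum>k. (1/3) ^ (k + Suc n) * d (k + Suc n)) + (\<Sum>k<Suc n. (1/3) ^ k * d k)"
    by (rule suminf_split_initial_segment[OF sd])
  also have "(\<Sum>k<Suc n. (1/3) ^ k * d k) = (1/3) ^ n * d n"
    using less by (simp add: d_def)
  finally have *: "(1/3) ^ n * d n = - (\<Sum>k. (1/3) ^ (k + Suc n) * d (k + Suc n))" by simp
  have "(1/3) ^ n = \<bar>(1/3) ^ n * d n\<bar>" using n by (auto simp: d_def abs_mult)
  also have "\<dots> = \<bar>\<Sum>k. (1/3) ^ (k + Suc n) * d (k + Suc n)\<bar>" unfolding * by simp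
  also have "\<dots> \<le> (\<Sum>k. (1/3) ^ (k + Suc n))"
  proof -
    have 1: "summable (\<lambda>k. (1/3::real) ^ (k + Suc n))"
      using geo by (rule summable_ignore_initial_segment)
    have 2: "\<bar>(1/3) ^ (k + Suc n) * d (k + Suc n)\<bar> \<le> (1/3) ^ (k + Suc n)" for k
      using d[of "k + Suc n"] by (simp add: abs_mult mult_left_le)
    have 3: "summable (\<lambda>k. \<bar>(1/3) ^ (k + Suc n) * d (k + Suc n)\<bar>)"
      by (rule summable_comparison_test'[OF 1, of 0]) (use 2 in auto)
    show ?thesis
      using summable_rabs[OF 3] suminf_le[OF 2 3 1] by linarith
  qed
  also have "\<dots> = (1/3) ^ Suc n * (\<Sum>k. (1/3) ^ k)"
    unfolding power_add by (subst suminf_mult2[OF geo, symmetric]) simp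
  also have "\<dots> = (1/3) ^ n / 2" by (simp add: suminf_geometric)
  finally show False by simp
qed

text \<open>The clamped quotient is the distribution function of the uniform law on (0, b]. It is
  multiplied by the measure of \<open>A\<close> instead of conditioning on \<open>A\<close>, so null
  sets cause no division by zero.\<close>

definition uniform_on :: "'a measure \<Rightarrow> 'a set \<Rightarrow> ('a \<Rightarrow> real) \<Rightarrow> real \<Rightarrow> bool" where
  "uniform_on M A V b \<longleftrightarrow> V \<in> borel_measurable M \<and>
     (\<forall>a. measure M {x\<in>A. V x \<le> a} = max 0 (min 1 (a / b)) * measure M A)"

lemma sets_Collect_in:
  assumes "A \<in> sets M" "Measurable.pred M P"
  shows "{x\<in>A. P x} \<in> sets M"
proof -
  have "{x\<in>A. P x} = A \<inter> {x\<in>space M. P x}" using sets.sets_into_space[OF assms(1)] by auto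
  then show ?thesis using assms by simp
qed

context measure_tree
begin

text \<open>Points with the same value of \<open>U\<close> lie in the same tree sets, and these shrink.\<close>

lemma exists_diffuse:
  "\<exists>U\<in>borel_measurable M. \<forall>c::real. prob {x\<in>space M. U x = c} = 0"
proof -
  define J where "J = from_nat_into T"
  have J: "J n \<in> T" for n
    unfolding J_def using root_in_tree by (intro from_nat_into) auto
  define U where "U x = (\<Sum>n. (1/3::real) ^ n * of_bool (x \<in> J n))" for x
  have [measurable]: "J n \<in> sets M" for n using J sets_tree by blast
  have U: "U \<in> borel_measurable M" unfolding U_def by measurable
  moreover have "prob {x\<in>space M. U x = c} = 0" for c
  proof (cases "{x\<in>space M. U x = c} = {}")
    case True
    then show ?thesis by (metis measure_empty)
  next
    case False
    then obtain x0 where x0: "x0 \<in> space M" "U x0 = c" by auto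
    have sub: "{x\<in>space M. U x = c} \<subseteq> I" if I: "I \<in> T" "x0 \<in> I" for I
    proof
      fix x assume "x \<in> {x\<in>space M. U x = c}"
      then have "U x = U x0" using x0 by simp
      then have "(\<lambda>n. x \<in> J n) = (\<lambda>n. x0 \<in> J n)"
        unfolding U_def by (rule ternary_expansion_inj)
      moreover obtain n where "I = J n"
        using from_nat_into_surj[OF countable_tree I(1)] unfolding J_def by metis
      ultimately show "x \<in> I" using I(2) by metis
    qed
    have "prob {x\<in>space M. U x = c} \<le> e" if e: "0 < e" for e
    proof -
      obtain n where n: "\<And>I. I \<in> tree_level C (space M) n \<Longrightarrow> prob I < e"
        using level_measure_small[OF e] unfolding eventually_sequentially by blast
      obtain I where I: "I \<in> tree_level C (space M) n" "x0 \<in> I"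
        using Union_level[of n] x0 by blast
      have "prob {x\<in>space M. U x = c} \<le> prob I"
        using I level_in_tree by (intro finite_measure_mono sub) (auto simp: sets_tree)
      then show ?thesis using n[OF I(1)] by simp
    qed
    then have "\<not> 0 < prob {x\<in>space M. U x = c}"
      using dense[of 0 "prob {x\<in>space M. U x = c}"] by (meson not_le)
    then show ?thesis by (simp add: zero_less_measure_iff)
  qed
  ultimately show ?thesis by blast
qed

text \<open>The law of the diffuse variable \<open>U\<close> on \<open>A\<close> has a continuous distribution function \<open>D\<close>,
  so \<open>D \<circ> U\<close> is uniform.\<close>

lemma uniform_on_exists:
  assumes A: "A \<in> sets M"
  shows "\<exists>W. uniform_on M A W 1"
proof (cases "prob A = 0")
  case True
  have "prob {x\<in>A. (0::real) \<le> a} = 0" for a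
    using True A measure_mono_fmeasurable[of "{x\<in>A. (0::real) \<le> a}" A M]
    by (auto simp: fmeasurable_eq_sets measure_le_0_iff)
  then show ?thesis using True by (auto simp: uniform_on_def intro!: exI[of _ "\<lambda>_. 0"])
next
  case False
  then have pos: "0 < prob A" by (simp add: zero_less_measure_iff)
  obtain U :: "'a \<Rightarrow> real" where U[measurable]: "U \<in> borel_measurable M"
    and U0: "\<And>c. prob {x\<in>space M. U x = c} = 0"
    using exists_diffuse by auto
  define N where "N = uniform_measure M A"
  have N: "prob_space N"
    unfolding N_def using pos by (intro prob_space_uniform_measure) (auto simp: emeasure_eq_measure)
  interpret N: prob_space N by (rule N)
  have [measurable]: "U \<in> borel_measurable N" unfolding N_def by simp
  define D where "D = distr N borel U"
  interpret D: real_distribution D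
    unfolding D_def by (rule N.real_distribution_distr) simp
  have mN: "measure N B = prob (A \<inter> B) / prob A" if "B \<in> sets M" for B
    unfolding N_def using pos that A
    by (intro measure_uniform_measure) (auto simp: emeasure_eq_measure)
  have spN: "space N = space M" by (simp add: N_def)
  have cdf_eq: "cdf D c = prob {x\<in>A. U x \<le> c} / prob A" for c
  proof -
    have "cdf D c = measure N {x\<in>space M. U x \<le> c}"
      unfolding cdf_def D_def by (subst measure_distr) (auto simp: spN vimage_def Int_def conj_commute)
    also have "\<dots> = prob (A \<inter> {x\<in>space M. U x \<le> c}) / prob A" by (rule mN) measurable
    also have "A \<inter> {x\<in>space M. U x \<le> c} = {x\<in>A. U x \<le> c}"
      using sets.sets_into_space[OF A] by auto
    finally show ?thesis .
  qed
  have "measure D {c} = 0" for c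
  proof -
    have "measure D {c} = measure N {x\<in>space M. U x = c}"
      unfolding D_def by (subst measure_distr) (auto simp: spN vimage_def Int_def conj_commute)
    also have "\<dots> = prob (A \<inter> {x\<in>space M. U x = c}) / prob A" by (rule mN) measurable
    also have "prob (A \<inter> {x\<in>space M. U x = c}) \<le> prob {x\<in>space M. U x = c}"
      by (intro finite_measure_mono) auto
    then have "prob (A \<inter> {x\<in>space M. U x = c}) = 0" using U0[of c] by (simp add: measure_le_0_iff)
    finally show ?thesis by simp
  qed
  then have cont: "isCont (cdf D) c" for c by (simp add: D.isCont_cdf)
  have mono: "mono (cdf D)" by (auto simp: mono_def D.cdf_nondecreasing)
  define W where "W x = cdf D (U x)" for x
  have [measurable]: "cdf D \<in> borel_measurable borel" by (rule borel_measurable_mono[OF mono])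
  have W[measurable]: "W \<in> borel_measurable M" unfolding W_def by measurable
  have W01: "0 \<le> W x" "W x \<le> 1" for x
    unfolding W_def by (auto simp: D.cdf_nonneg D.cdf_bounded_prob)
  have sets_W: "{x\<in>A. W x \<le> a} \<in> sets M" for a
    by (rule sets_Collect_in[OF A]) measurable
  have inner: "prob {x\<in>A. W x \<le> s} = s * prob A" if s: "0 < s" "s < 1" for s
  proof -
    obtain c0 where c0: "cdf D c0 < s"
      using order_tendstoD(2)[OF D.cdf_lim_at_bot s(1)] by (auto simp: eventually_at_bot_linorder)
    obtain c1 where c1: "s < cdf D c1"
      using order_tendstoD(1)[OF D.cdf_lim_at_top_prob s(2)] by (auto simp: eventually_at_top_linorder)
    \<comment> \<open>\<open>S\<close> is a closed half-line. Its right end point has distribution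
      value exactly s, by the intermediate value theorem, so the sublevel sets of \<open>W\<close>
      are sublevel sets of \<open>U\<close>.\<close>
    define S where "S = {c. cdf D c \<le> s}"
    have bdd: "c \<le> c1" if "c \<in> S" for c
      using that c1 D.cdf_nondecreasing[of c1 c] by (force simp: S_def)
    have "closed S" unfolding S_def
      using cont by (intro closed_Collect_le continuous_on_const)
        (auto simp: continuous_on_eq_continuous_at)
    then have Sup_in: "Sup S \<in> S"
      using bdd c0 by (intro closed_contains_Sup) (auto simp: S_def bdd_above_def intro: less_imp_le)
    have "c0 \<le> c1" using bdd c0 by (auto simp: S_def)
    then obtain c where c: "cdf D c = s"
      using IVT[of "cdf D" c0 s c1] c0 c1 cont by auto
    have "c \<le> Sup S" using c bdd by (intro cSup_upper) (auto simp: S_def bdd_above_def)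
    then have Sup_eq: "cdf D (Sup S) = s"
      using D.cdf_nondecreasing[of c "Sup S"] c Sup_in by (auto simp: S_def)
    have "W x \<le> s \<longleftrightarrow> U x \<le> Sup S" for x
    proof
      assume "W x \<le> s" then show "U x \<le> Sup S"
        using bdd by (intro cSup_upper) (auto simp: S_def W_def bdd_above_def)
    next
      assume "U x \<le> Sup S" then show "W x \<le> s"
        using D.cdf_nondecreasing[of "U x" "Sup S"] Sup_eq by (simp add: W_def)
    qed
    then have "prob {x\<in>A. W x \<le> s} = prob A * cdf D (Sup S)" using pos by (simp add: cdf_eq)
    then show ?thesis using Sup_eq by simp
  qed
  have "prob {x\<in>A. W x \<le> a} = max 0 (min 1 (a / 1)) * prob A" for a
  proof -
    consider "a < 0" | "a = 0" | "0 < a" "a < 1" | "1 \<le> a" by linarith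
    then show ?thesis
    proof cases
      case 1
      then have "{x\<in>A. W x \<le> a} = {}" using W01(1) by (auto intro: order_trans simp: not_le less_le_trans)
      then show ?thesis using 1 by (metis div_by_1 less_imp_le max.absorb1 measure_empty min.coboundedI2 mult_zero_left)
    next
      case 2
      \<comment> \<open>No c with \<open>cdf D c = 0\<close> need exist, so a = 0 is reached by
        letting s decrease to 0.\<close>
      have "prob {x\<in>A. W x \<le> 0} \<le> s * prob A" if "0 < s" "s < 1" for s
        unfolding inner[OF that, symmetric] using that sets_W by (intro finite_measure_mono) auto
      then have "prob {x\<in>A. W x \<le> 0} \<le> s" if "0 < s" "s < 1" for s
        using that prob_le_1[of A] by (meson less_imp_le mult_left_le order_trans)
      then have "\<not> 0 < prob {x\<in>A. W x \<le> 0}"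
        using dense[of 0 "min 1 (prob {x\<in>A. W x \<le> 0})"] by (meson min_less_iff_conj not_le zero_less_one)
      then show ?thesis using 2 by (simp add: zero_less_measure_iff)
    next
      case 3 then show ?thesis using inner by simp
    next
      case 4
      then have "{x\<in>A. W x \<le> a} = A" using W01(2) by (auto intro: order_trans)
      then show ?thesis using 4 by simp
    qed
  qed
  then show ?thesis unfolding uniform_on_def using W by blast
qed

end

section \<open>Uniform variables adapted to a tree\<close>

text \<open>On overlaps the prescriptions may conflict, so a point follows the first member of an
  enumeration that contains it. Off the null set of pairwise overlaps only one member contains it,
  and the prescription is unambiguous.\<close>

lemma glue_null_Int:
  fixes V :: "'a set \<Rightarrow> 'a \<Rightarrow> real"
  assumes F: "countable F" "F \<noteq> {}" "F \<subseteq> sets M"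
    and null: "pairwise (\<lambda>A B. A \<inter> B \<in> null_sets M) F"
    and V: "\<And>J. J \<in> F \<Longrightarrow> V J \<in> borel_measurable M" "V0 \<in> borel_measurable M"
  shows "\<exists>W\<in>borel_measurable M. \<exists>N\<in>null_sets M.
    (\<forall>J\<in>F. \<forall>x\<in>J - N. W x = V J x) \<and> (\<forall>x\<in>space M - \<Union>F. W x = V0 x)"
proof -
  define E where "E = from_nat_into F"
  have E: "E n \<in> F" for n unfolding E_def using F by (intro from_nat_into)
  have [measurable]: "E n \<in> sets M" for n using E F by blast
  have [measurable]: "V (E n) \<in> borel_measurable M" "V0 \<in> borel_measurable M" for n
    using V E by auto
  have UF [measurable]: "\<Union>F \<in> sets M" using F by (intro sets.countable_Union)
  define i where "i x = (LEAST n. x \<in> E n)" for x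
  have [measurable]: "i \<in> measurable M (count_space UNIV)"
    unfolding i_def by measurable
  define W where "W x = (if x \<in> \<Union>F then V (E (i x)) x else V0 x)" for x
  have [measurable]: "(\<lambda>x. V (E (i x)) x) \<in> borel_measurable M"
    by (rule measurable_compose_countable[where f="\<lambda>n. V (E n)"]) auto
  have W: "W \<in> borel_measurable M" unfolding W_def by measurable
  define N where "N = (\<Union>A\<in>F. \<Union>B\<in>F - {A}. A \<inter> B)"
  have N: "N \<in> null_sets M" unfolding N_def
  proof (intro null_sets_UN')
    fix A B assume "A \<in> F" "B \<in> F - {A}"
    then show "A \<inter> B \<in> null_sets M" by (intro pairwiseD[OF null]) auto
  qed (use F in auto)
  have "W x = V J x" if J: "J \<in> F" and x: "x \<in> J - N" for J x
  proof -
    obtain n where "J = E n" using from_nat_into_surj[OF F(1) J] unfolding E_def by metis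
    then have "x \<in> E (i x)" unfolding i_def using x by (auto intro: LeastI)
    then have "E (i x) = J" using x J E[of "i x"] by (auto simp: N_def)
    then show ?thesis using x J by (auto simp: W_def)
  qed
  then show ?thesis using W N by (intro bexI[of _ W] bexI[of _ N]) (auto simp: W_def)
qed

section \<open>Proportions of a set inside almost disjoint unions\<close>

context finite_measure
begin

text \<open>Disjointing an enumeration changes each member only by a null set, so the inequalities
  for the members can be summed.\<close>

lemma measure_Union_Int_ge:
  assumes F: "countable F" "F \<subseteq> sets M"
    and null: "pairwise (\<lambda>A B. A \<inter> B \<in> null_sets M) F"
    and B: "B \<in> sets M"
    and le: "\<And>J. J \<in> F \<Longrightarrow> c * measure M J \<le> measure M (J \<inter> B)"
  shows "c * measure M (\<Union>F) \<le> measure M (\<Union>F \<inter> B)"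
proof (cases "F = {}")
  case False
  define E where "E = from_nat_into F"
  have rE: "range E = F" unfolding E_def using F False by (intro range_from_nat_into)
  then have E: "E n \<in> F" for n by auto
  have Es: "E n \<in> sets M" for n using E F by blast
  define D where "D = disjointed E"
  have Ds: "D n \<in> sets M" for n
    unfolding D_def using Es by (metis range_subsetD sets.range_disjointed_sets image_subsetI)
  have UD: "(\<Union>n. D n) = \<Union>F" unfolding D_def UN_disjointed_eq using rE by auto
  have disj: "disjoint_family D" unfolding D_def by (rule disjoint_family_disjointed)
  have le': "c * measure M (D n) \<le> measure M (D n \<inter> B)" for n
  proof (cases "\<exists>i<n. E i = E n")
    \<comment> \<open>The enumeration repeats members when \<open>F\<close> is finite. A repetition
      leaves an empty piece; it must be split off because its overlap with the earlier copy is the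
      whole member.\<close>
    case True
    then have "D n = {}" unfolding D_def disjointed_def by auto
    then show ?thesis by simp
  next
    case neq: False
    define N where "N = (\<Union>i<n. E n \<inter> E i)"
    have N: "N \<in> null_sets M" unfolding N_def
    proof (intro null_sets_UN')
      fix i assume "i \<in> {..<n}"
      then show "E n \<inter> E i \<in> null_sets M"
        using neq E by (intro pairwiseD[OF null]) (metis lessThan_iff)+
    qed auto
    have D_eq: "D n = E n - N" by (auto simp: D_def disjointed_def N_def)
    have "measure M (D n) = measure M (E n)" "measure M (D n \<inter> B) = measure M (E n \<inter> B)"
      using Ds Es B N by (auto intro!: measure_eq_if_null_diff[OF _ _ N] simp: D_eq)
    then show ?thesis using le[OF E] by simp
  qed
  have "(\<lambda>n. c * measure M (D n)) sums (c * measure M (\<Union>F))"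
    using sums_mult[OF finite_measure_UNION[of D]] Ds disj UD by auto
  moreover have "(\<lambda>n. measure M (D n \<inter> B)) sums measure M (\<Union>n. D n \<inter> B)"
    using Ds B disj by (intro finite_measure_UNION) (auto simp: disjoint_family_on_def)
  moreover have "(\<Union>n. D n \<inter> B) = \<Union>F \<inter> B" using UD by auto
  ultimately show ?thesis using sums_le[OF le'] by simp
qed simp

text \<open>The one-sided inequality for \<open>B\<close> with ratio c, together with the one for
  the complement of \<open>B\<close> with ratio 1 - c.\<close>

lemma measure_Union_Int_eq:
  assumes F: "countable F" "F \<subseteq> sets M"
    and null: "pairwise (\<lambda>A B. A \<inter> B \<in> null_sets M) F"
    and B: "B \<in> sets M"
    and eq: "\<And>J. J \<in> F \<Longrightarrow> measure M (J \<inter> B) = c * measure M J"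
  shows "measure M (\<Union>F \<inter> B) = c * measure M (\<Union>F)"
proof (rule antisym)
  have split: "measure M (A \<inter> (space M - B)) = measure M A - measure M (A \<inter> B)"
    if "A \<in> sets M" for A
  proof -
    have "A \<inter> (space M - B) = A - A \<inter> B" using sets.sets_into_space[OF that] by auto
    then show ?thesis using that B by (simp add: finite_measure_Diff)
  qed
  have UF: "\<Union>F \<in> sets M" using F by (intro sets.countable_Union)
  have "(1 - c) * measure M (\<Union>F) \<le> measure M (\<Union>F \<inter> (space M - B))"
    using F null B eq by (intro measure_Union_Int_ge) (auto simp: split subset_eq algebra_simps)
  then show "measure M (\<Union>F \<inter> B) \<le> c * measure M (\<Union>F)"
    unfolding split[OF UF] by (simp add: algebra_simps)
  show "c * measure M (\<Union>F) \<le> measure M (\<Union>F \<inter> B)"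
    using F null B eq by (intro measure_Union_Int_ge) auto
qed

end

context measure_tree
begin

text \<open>In the induction step, a subfamily \<open>F\<close> of relative measure \<open>r\<close> carries the rescaled variables
  \<open>r V\<^sub>J\<close>, and the rest of \<open>I\<close> a variable uniform on \<open>(r, 1]\<close>.\<close>

lemma uniform_tower:
  assumes r: "0 < r" "r < 1" and "I \<in> T"
  shows "\<exists>V. uniform_on M I V 1 \<and>
    (\<forall>j\<le>N. r ^ j * prob I \<le> prob (\<Union>{K\<in>T. K \<subseteq> I \<and> uniform_on M K V (r ^ j)}))"
  using \<open>I \<in> T\<close>
proof (induction N arbitrary: I)
  case 0
  obtain V where V: "uniform_on M I V 1" using uniform_on_exists 0 sets_tree by blast
  then have "\<Union>{K\<in>T. K \<subseteq> I \<and> uniform_on M K V (r ^ 0)} = I" using 0 by auto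
  then show ?case using V by (intro exI[of _ V]) simp
next
  case (Suc N)
  have posI: "0 < prob I" using Suc.prems tree_pos by blast
  have Is[measurable]: "I \<in> sets M" using Suc.prems sets_tree by blast
  obtain F where F: "F \<subseteq> T" "\<And>J. J \<in> F \<Longrightarrow> J \<subseteq> I"
    and null: "pairwise (\<lambda>A B. A \<inter> B \<in> null_sets M) F" and pF: "prob (\<Union>F) = r * prob I"
    using exact_subfamily[OF Suc.prems, of "r * prob I"] r posI by auto
  have "F \<noteq> {}" using pF r posI by auto
  have cF: "countable F" using F(1) countable_tree countable_subset by blast
  have Fs: "F \<subseteq> sets M" using F(1) sets_tree by blast
  have UF[measurable]: "\<Union>F \<in> sets M" using F by auto
  have "\<forall>J\<in>F. \<exists>V. uniform_on M J V 1 \<and>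
    (\<forall>j\<le>N. r ^ j * prob J \<le> prob (\<Union>{K\<in>T. K \<subseteq> J \<and> uniform_on M K V (r ^ j)}))"
    using Suc.IH F(1) by blast
  from bchoice[OF this] obtain VJ where VJ: "\<And>J. J \<in> F \<Longrightarrow> uniform_on M J (VJ J) 1"
    "\<And>J j. J \<in> F \<Longrightarrow> j \<le> N \<Longrightarrow>
      r ^ j * prob J \<le> prob (\<Union>{K\<in>T. K \<subseteq> J \<and> uniform_on M K (VJ J) (r ^ j)})"
    by blast
  define P where "P = I - \<Union>F"
  have P[measurable]: "P \<in> sets M" unfolding P_def by measurable
  have UFI: "\<Union>F \<subseteq> I" using F(2) by blast
  have probP: "prob P = (1 - r) * prob I"
    unfolding P_def using UFI pF by (simp add: finite_measure_Diff algebra_simps)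
  obtain W where W: "uniform_on M P W 1" using uniform_on_exists[OF P] by blast
  have [measurable]: "W \<in> borel_measurable M" using W by (simp add: uniform_on_def)
  have VJm: "VJ J \<in> borel_measurable M" if "J \<in> F" for J
    using VJ(1)[OF that] by (simp add: uniform_on_def)
  obtain V Z where V[measurable]: "V \<in> borel_measurable M" and Z: "Z \<in> null_sets M"
    and V1: "\<And>J x. J \<in> F \<Longrightarrow> x \<in> J - Z \<Longrightarrow> V x = r * VJ J x"
    and V0: "\<And>x. x \<in> space M - \<Union>F \<Longrightarrow> V x = r + (1 - r) * W x"
    using glue_null_Int[OF cF \<open>F \<noteq> {}\<close> Fs null, of "\<lambda>J x. r * VJ J x" "\<lambda>x. r + (1 - r) * W x"] VJm
    by auto
  \<comment> \<open>The null set \<open>Z\<close> of gluing conflicts does not affect the law of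
    \<open>V\<close> on \<open>K\<close>. Multiplication by r turns scale \<open>r ^ i\<close> for
    \<open>VJ J\<close> into scale \<open>r ^ Suc i\<close> for \<open>V\<close>, which drives the
    induction.\<close>
  have scale: "uniform_on M K V (r * b)"
    if J: "J \<in> F" and K: "K \<subseteq> J" "K \<in> sets M" and u: "uniform_on M K (VJ J) b" for J K b
  proof -
    have [measurable]: "VJ J \<in> borel_measurable M" using VJm J by simp
    have "prob {x\<in>K. V x \<le> a} = prob {x\<in>K. VJ J x \<le> a / r}" for a
    proof (rule measure_eq_if_null_diff[OF _ _ Z])
      show "{x\<in>K. V x \<le> a} - Z = {x\<in>K. VJ J x \<le> a / r} - Z"
        using V1[OF J] K r by (auto simp: field_simps)
    qed (intro sets_Collect_in K, measurable)+
    then show ?thesis using u by (simp add: uniform_on_def)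
  qed
  have setsV: "{x\<in>space M. V x \<le> a} \<in> sets M" for a by measurable
  have "prob (J \<inter> {x\<in>space M. V x \<le> a}) = max 0 (min 1 (a / r)) * prob J" if "J \<in> F" for J a
  proof -
    have Js: "J \<in> sets M" using that Fs by blast
    have "J \<inter> {x\<in>space M. V x \<le> a} = {x\<in>J. V x \<le> a}" using sets.sets_into_space[OF Js] by auto
    then show ?thesis using scale[OF that order_refl Js VJ(1)[OF that]] by (simp add: uniform_on_def)
  qed
  then have onF: "prob (\<Union>F \<inter> {x\<in>space M. V x \<le> a}) = max 0 (min 1 (a / r)) * (r * prob I)" for a
    unfolding pF[symmetric] by (intro measure_Union_Int_eq[OF cF Fs null setsV])
  have onP: "prob {x\<in>P. V x \<le> a} = max 0 (min 1 ((a - r) / (1 - r))) * ((1 - r) * prob I)" for a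
  proof -
    have "V x \<le> a \<longleftrightarrow> W x \<le> (a - r) / (1 - r)" if "x \<in> P" for x
    proof -
      have Vx: "V x = r + (1 - r) * W x"
        using that sets.sets_into_space[OF Is] by (intro V0) (auto simp: P_def)
      have "V x \<le> a \<longleftrightarrow> W x * (1 - r) \<le> a - r"
        unfolding Vx by (simp add: algebra_simps)
      also have "\<dots> \<longleftrightarrow> W x \<le> (a - r) / (1 - r)" using r by (simp add: pos_le_divide_eq)
      finally show ?thesis .
    qed
    then have "{x\<in>P. V x \<le> a} = {x\<in>P. W x \<le> (a - r) / (1 - r)}" by (intro Collect_cong conj_cong refl)
    then show ?thesis using W by (simp add: uniform_on_def probP del: mult_eq_0_iff)
  qed
  have "prob {x\<in>I. V x \<le> a} = max 0 (min 1 (a / 1)) * prob I" for a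
  proof -
    have "{x\<in>I. V x \<le> a} = (\<Union>F \<inter> {x\<in>space M. V x \<le> a}) \<union> {x\<in>P. V x \<le> a}"
      using UFI sets.sets_into_space[OF Is] by (auto simp: P_def)
    also have "prob \<dots> = prob (\<Union>F \<inter> {x\<in>space M. V x \<le> a}) + prob {x\<in>P. V x \<le> a}"
      by (intro finite_measure_Union sets_Collect_in) (auto simp: P_def)
    also have "\<dots> = (max 0 (min 1 (a / r)) * r + max 0 (min 1 ((a - r) / (1 - r))) * (1 - r)) * prob I"
      unfolding onF onP by (simp add: algebra_simps)
    \<comment> \<open>Below r only the family \<open>F\<close> contributes; from r on it is
      exhausted and only the rest \<open>P\<close> still grows.\<close>
    also have "max 0 (min 1 (a / r)) * r + max 0 (min 1 ((a - r) / (1 - r))) * (1 - r) = max 0 (min 1 a)"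
    proof (cases "a < r")
      case True
      then have "(a - r) / (1 - r) \<le> 0" "a / r \<le> 1" using r by (auto simp: divide_nonpos_pos)
      then show ?thesis using True r by (auto simp: max_def zero_le_divide_iff)
    next
      case False
      then have "0 \<le> (a - r) / (1 - r)" "1 \<le> a / r" using r by auto
      moreover have "(a - r) / (1 - r) \<le> 1 \<longleftrightarrow> a \<le> 1" using r by (simp add: pos_divide_le_eq)
      ultimately show ?thesis using False r by (auto simp: max_def min_def)
    qed
    finally show ?thesis by simp
  qed
  then have unif: "uniform_on M I V 1" by (simp add: uniform_on_def)
  have "r ^ j * prob I \<le> prob (\<Union>{K\<in>T. K \<subseteq> I \<and> uniform_on M K V (r ^ j)})" if j: "j \<le> Suc N" for j
  proof (cases j)
    case 0
    then have "\<Union>{K\<in>T. K \<subseteq> I \<and> uniform_on M K V (r ^ j)} = I" using Suc.prems unif by auto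
    then show ?thesis using 0 by simp
  next
    \<comment> \<open>Each member of \<open>F\<close> is covered in proportion at least
      \<open>r ^ i\<close> by its own tower. The missing factor r is the relative measure of
      \<open>F\<close> in \<open>I\<close>. Scale 0 is served by \<open>I\<close> itself.\<close>
    case (Suc i)
    define B where "B = \<Union>{K\<in>T. K \<subseteq> I \<and> uniform_on M K V (r ^ j)}"
    have B[measurable]: "B \<in> sets M" unfolding B_def by (intro Union_sets) auto
    have "r ^ i * prob J \<le> prob (J \<inter> B)" if J: "J \<in> F" for J
    proof -
      have Js: "J \<in> sets M" using J Fs by blast
      have "r ^ i * prob J \<le> prob (\<Union>{K\<in>T. K \<subseteq> J \<and> uniform_on M K (VJ J) (r ^ i)})"
        using VJ(2)[OF J] j Suc by simp
      also have "\<dots> \<le> prob (J \<inter> B)"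
      proof (rule finite_measure_mono)
        show "\<Union>{K\<in>T. K \<subseteq> J \<and> uniform_on M K (VJ J) (r ^ i)} \<subseteq> J \<inter> B"
        proof (rule Union_least)
          fix K assume "K \<in> {K\<in>T. K \<subseteq> J \<and> uniform_on M K (VJ J) (r ^ i)}"
          then have K: "K \<in> T" "K \<subseteq> J" "uniform_on M K (VJ J) (r ^ i)" by auto
          then have "uniform_on M K V (r ^ j)"
            using scale[OF J K(2) _ K(3)] sets_tree Suc by simp
          then have "K \<in> {K\<in>T. K \<subseteq> I \<and> uniform_on M K V (r ^ j)}"
            using K F(2)[OF J] by blast
          then show "K \<subseteq> J \<inter> B" using K(2) unfolding B_def by (metis Int_greatest Union_upper)
        qed
      qed (use Js B in auto)
      finally show ?thesis .
    qed
    then have "r ^ i * prob (\<Union>F) \<le> prob (\<Union>F \<inter> B)"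
      by (intro measure_Union_Int_ge[OF cF Fs null B])
    also have "\<dots> \<le> prob B" by (intro finite_measure_mono) auto
    finally show ?thesis unfolding pF Suc B_def by (simp add: mult_ac)
  qed
  then show ?case using unif by blast
qed

end

section \<open>Maximal operator and rearrangement\<close>

lemma decr_rearr_le:
  assumes "\<And>s. a < s \<Longrightarrow> emeasure M {x\<in>space M. s < g x} < ennreal t"
  shows "decr_rearr M g t \<le> a"
proof (rule dense_ge)
  fix s assume "a < s"
  then show "decr_rearr M g t \<le> s"
    unfolding decr_rearr_def using assms by (intro Inf_lower) auto
qed

lemma le_decr_rearr:
  assumes E: "E \<subseteq> {x\<in>space M. a \<le> g x}" "ennreal t \<le> emeasure M E"
    and "\<And>s. {x\<in>space M. s < g x} \<in> sets M"
  shows "a \<le> decr_rearr M g t"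
  unfolding decr_rearr_def
proof (rule Inf_greatest)
  fix s assume s: "s \<in> {s. emeasure M {x\<in>space M. s < g x} < ennreal t}"
  show "a \<le> s"
  proof (rule ccontr)
    assume "\<not> a \<le> s"
    then have "E \<subseteq> {x\<in>space M. s < g x}" using E(1) by (auto simp: not_le)
    then have "emeasure M E \<le> emeasure M {x\<in>space M. s < g x}"
      using assms(3) by (intro emeasure_mono) auto
    then show False using s E(2) by auto
  qed
qed

lemma measure_superlevel_less:
  assumes "decr_rearr M g t < s" "\<And>s. {x\<in>space M. s < g x} \<in> sets M"
  shows "emeasure M {x\<in>space M. s < g x} < ennreal t"
proof -
  obtain s' where s': "emeasure M {x\<in>space M. s' < g x} < ennreal t" "s' < s"
    using assms(1) unfolding decr_rearr_def Inf_less_iff by auto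
  have "emeasure M {x\<in>space M. s < g x} \<le> emeasure M {x\<in>space M. s' < g x}"
    using s'(2) assms(2) by (intro emeasure_mono) auto
  then show ?thesis using s'(1) by simp
qed

section \<open>The weak type inequality with the integral over the superlevel set\<close>

lemma tree_level_Suc_children: "tree_level C I (Suc n) = (\<Union>J\<in>C I. tree_level C J n)"
  by (induction n) auto

text \<open>Going down \<open>n\<close> generations from \<open>I\<close>, stop at the first sets with property \<open>P\<close>. This replaces
  the decomposition of a superlevel set into maximal tree sets.\<close>

primrec first_hits :: "('a set \<Rightarrow> 'a set set) \<Rightarrow> ('a set \<Rightarrow> bool) \<Rightarrow> nat \<Rightarrow> 'a set \<Rightarrow> 'a set" where
  "first_hits C P 0 I = (if P I then I else {})"
| "first_hits C P (Suc n) I = (if P I then I else (\<Union>J\<in>C I. first_hits C P n J))"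

context measure_tree
begin

lemma first_hits_subset: "I \<in> T \<Longrightarrow> first_hits C P n I \<subseteq> I"
proof (induction n arbitrary: I)
  case (Suc n)
  then have "first_hits C P n J \<subseteq> I" if "J \<in> C I" for J
    using children_le children_in_tree that by blast
  then show ?case by auto
qed auto

lemma first_hits_sets: "I \<in> T \<Longrightarrow> first_hits C P n I \<in> sets M"
proof (induction n arbitrary: I)
  case (Suc n)
  then have "(\<Union>J\<in>C I. first_hits C P n J) \<in> sets M"
    using finite_children children_in_tree by (intro sets.finite_UN) auto
  then show ?case using Suc.prems sets_tree by auto
qed (auto simp: sets_tree)

lemma first_hits_Suc: "I \<in> T \<Longrightarrow> first_hits C P n I \<subseteq> first_hits C P (Suc n) I"
proof (induction n arbitrary: I)
  case (Suc n)
  have "first_hits C P n J \<subseteq> first_hits C P (Suc n) J" if "J \<in> C I" for J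
    using Suc children_in_tree that by blast
  then show ?case by (auto simp del: first_hits.simps(2) simp: first_hits.simps(2)[of _ _ n I]
    first_hits.simps(2)[of _ _ "Suc n" I])
qed auto

text \<open>\<open>K\<close> itself may never be reached: an ancestor with property \<open>P\<close>
  may stop the descent earlier, but that ancestor contains \<open>K\<close>.\<close>

lemma first_hits_level:
  "I \<in> T \<Longrightarrow> K \<in> tree_level C I n \<Longrightarrow> P K \<Longrightarrow> K \<subseteq> first_hits C P n I"
proof (induction n arbitrary: I)
  case (Suc n)
  then obtain J where J: "J \<in> C I" "K \<in> tree_level C J n"
    unfolding tree_level_Suc_children by blast
  then have *: "K \<subseteq> first_hits C P n J" using Suc children_in_tree by blast
  moreover have "first_hits C P n J \<subseteq> I"
    using first_hits_subset children_le children_in_tree J Suc.prems by blast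
  ultimately show ?case using J by auto
qed auto

lemma first_hits_le_Union: "I \<in> T \<Longrightarrow> first_hits C P n I \<subseteq> \<Union>{I\<in>T. P I}"
proof (induction n arbitrary: I)
  case (Suc n)
  then have "first_hits C P n J \<subseteq> \<Union>{I\<in>T. P I}" if "J \<in> C I" for J
    using children_in_tree that by blast
  then show ?case using Suc.prems by auto
qed auto

text \<open>Off the null set of overlaps of siblings a point lies in at most one \<open>A J\<close>,
  so the sum of the indicators is the indicator of the union.\<close>

lemma sum_nn_integral_children_le:
  assumes I: "I \<in> T" and \<psi>[measurable]: "\<psi> \<in> borel_measurable M"
    and A: "\<And>J. J \<in> C I \<Longrightarrow> A J \<subseteq> J" "\<And>J. J \<in> C I \<Longrightarrow> A J \<in> sets M"
  shows "(\<Sum>J\<in>C I. \<integral>\<^sup>+x\<in>A J. \<psi> x \<partial>M) \<le> (\<integral>\<^sup>+x\<in>(\<Union>J\<in>C I. A J). \<psi> x \<partial>M)"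
proof -
  define N where "N = (\<Union>J\<in>C I. \<Union>K\<in>C I - {J}. J \<inter> K)"
  have "countable (C I)" using finite_children[OF I] by (rule countable_finite)
  then have N: "N \<in> null_sets M" unfolding N_def
    by (intro null_sets_UN' pairwiseD[OF children_null_Int[OF I]]) auto
  have "(\<Sum>J\<in>C I. \<integral>\<^sup>+x\<in>A J. \<psi> x \<partial>M) = (\<integral>\<^sup>+x. (\<Sum>J\<in>C I. \<psi> x * indicator (A J) x) \<partial>M)"
    using A(2) by (intro nn_integral_sum[symmetric]) auto
  also have "\<dots> \<le> (\<integral>\<^sup>+x\<in>(\<Union>J\<in>C I. A J). \<psi> x \<partial>M)"
  proof (rule nn_integral_mono_AE)
    show "AE x in M. (\<Sum>J\<in>C I. \<psi> x * indicator (A J) x) \<le> \<psi> x * indicator (\<Union>J\<in>C I. A J) x"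
      using AE_not_in[OF N]
    proof eventually_elim
      case (elim x)
      show ?case
      proof (cases "\<exists>J\<in>C I. x \<in> A J")
        case True
        then obtain J where J: "J \<in> C I" "x \<in> A J" by blast
        have "indicator (A K) x = (if K = J then 1 else 0::ennreal)" if K: "K \<in> C I" for K
        proof (cases "K = J")
          case False
          then have "x \<notin> A K" using J K A(1)[OF K] A(1)[OF J(1)] elim unfolding N_def by blast
          then show ?thesis using False by simp
        qed (use J in simp)
        then have "(\<Sum>K\<in>C I. \<psi> x * indicator (A K) x) = (\<Sum>K\<in>C I. if K = J then \<psi> x else 0)"
          by (intro sum.cong) auto
        then show ?thesis using J finite_children[OF I] by (auto simp: indicator_def)
      qed auto
    qed
  qed
  finally show ?thesis .
qed

text \<open>Where the descent stops the hypothesis applies. Elsewhere subadditivity handles the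
  measure, and almost disjointness of the children recombines the integrals.\<close>

lemma first_hits_integral:
  assumes \<psi>[measurable]: "\<psi> \<in> borel_measurable M"
    and P: "\<And>J. J \<in> T \<Longrightarrow> P J \<Longrightarrow> s * emeasure M J \<le> (\<integral>\<^sup>+x\<in>J. \<psi> x \<partial>M)"
  shows "I \<in> T \<Longrightarrow>
    s * emeasure M (first_hits C P n I) \<le> (\<integral>\<^sup>+x\<in>first_hits C P n I. \<psi> x \<partial>M)"
proof (induction n arbitrary: I)
  case 0 then show ?case using P by simp
next
  case (Suc n)
  show ?case
  proof (cases "P I")
    case True then show ?thesis using P Suc.prems by simp
  next
    case False
    have sets: "first_hits C P n J \<in> sets M" if "J \<in> C I" for J
      using first_hits_sets children_in_tree that Suc.prems by blast
    have "s * emeasure M (\<Union>J\<in>C I. first_hits C P n J)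
        \<le> s * (\<Sum>J\<in>C I. emeasure M (first_hits C P n J))"
      using finite_children[OF Suc.prems] sets
      by (intro mult_left_mono emeasure_subadditive_finite) auto
    also have "\<dots> = (\<Sum>J\<in>C I. s * emeasure M (first_hits C P n J))" by (rule sum_distrib_left)
    also have "\<dots> \<le> (\<Sum>J\<in>C I. \<integral>\<^sup>+x\<in>first_hits C P n J. \<psi> x \<partial>M)"
      using Suc.IH children_in_tree[OF Suc.prems] by (intro sum_mono) auto
    also have "\<dots> \<le> (\<integral>\<^sup>+x\<in>(\<Union>J\<in>C I. first_hits C P n J). \<psi> x \<partial>M)"
      using first_hits_subset children_in_tree[OF Suc.prems] sets
      by (intro sum_nn_integral_children_le[OF Suc.prems \<psi>]) auto
    finally show ?thesis using False by simp
  qed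
qed

text \<open>The first hits below the root increase with the depth and exhaust the union of all sets
  with property \<open>P\<close>, so the inequality passes to the limit by continuity of the measure
  from below.\<close>

lemma Union_hits_integral:
  assumes \<psi>[measurable]: "\<psi> \<in> borel_measurable M"
    and P: "\<And>J. J \<in> T \<Longrightarrow> P J \<Longrightarrow> s * emeasure M J \<le> (\<integral>\<^sup>+x\<in>J. \<psi> x \<partial>M)"
  shows "s * emeasure M (\<Union>{I\<in>T. P I}) \<le> (\<integral>\<^sup>+x\<in>\<Union>{I\<in>T. P I}. \<psi> x \<partial>M)"
proof -
  let ?H = "\<lambda>n. first_hits C P n (space M)" and ?E = "\<Union>{I\<in>T. P I}"
  have E: "(\<Union>n. ?H n) = ?E"
  proof
    show "(\<Union>n. ?H n) \<subseteq> ?E" using first_hits_le_Union[OF root_in_tree] by (intro UN_least)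
    show "?E \<subseteq> (\<Union>n. ?H n)"
    proof (rule Union_least)
      fix I assume "I \<in> {I\<in>T. P I}"
      then obtain n where "I \<in> tree_level C (space M) n" "P I" using tree_levels by blast
      then have "I \<subseteq> ?H n" by (intro first_hits_level[OF root_in_tree])
      then show "I \<subseteq> (\<Union>n. ?H n)" by blast
    qed
  qed
  have "s * emeasure M ?E = s * (SUP n. emeasure M (?H n))"
    unfolding E[symmetric] using first_hits_sets[OF root_in_tree]
    by (subst SUP_emeasure_incseq) (auto intro!: incseq_SucI first_hits_Suc root_in_tree simp del: first_hits.simps)
  also have "\<dots> = (SUP n. s * emeasure M (?H n))" by (rule SUP_mult_left_ennreal)
  also have "\<dots> \<le> (\<integral>\<^sup>+x\<in>?E. \<psi> x \<partial>M)"
  proof (rule SUP_least)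
    fix n
    have "s * emeasure M (?H n) \<le> (\<integral>\<^sup>+x\<in>?H n. \<psi> x \<partial>M)"
      by (rule first_hits_integral[OF \<psi> P root_in_tree])
    also have "\<dots> \<le> (\<integral>\<^sup>+x\<in>?E. \<psi> x \<partial>M)"
      using first_hits_le_Union[OF root_in_tree, of P n]
      by (intro nn_integral_mono) (auto simp del: first_hits.simps split: split_indicator)
    finally show "s * emeasure M (?H n) \<le> (\<integral>\<^sup>+x\<in>?E. \<psi> x \<partial>M)" .
  qed
  finally show ?thesis .
qed

lemma maximal_op_superlevel:
  "{x\<in>space M. s < maximal_op M T \<phi> x} =
    \<Union>{I\<in>T. s < (\<integral>\<^sup>+y\<in>I. ennreal \<bar>\<phi> y\<bar> \<partial>M) / emeasure M I}"
  unfolding maximal_op_def less_SUP_iff using sets.sets_into_space tree_sets by blast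

lemma maximal_op_superlevel_sets: "{x\<in>space M. s < maximal_op M T \<phi> x} \<in> sets M"
  unfolding maximal_op_superlevel by (intro Union_sets) auto

text \<open>The integral runs over the superlevel set alone. With the full norm on the right the
  constant would not see how much mass a set of given measure can hold, and the sharp bound would be
  lost.\<close>

lemma maximal_op_weak_type:
  assumes [measurable]: "\<phi> \<in> borel_measurable M"
  defines "E \<equiv> \<lambda>s. {x\<in>space M. s < maximal_op M T \<phi> x}"
  shows "s * emeasure M (E s) \<le> (\<integral>\<^sup>+x\<in>E s. ennreal \<bar>\<phi> x\<bar> \<partial>M)"
  unfolding E_def maximal_op_superlevel
proof (rule Union_hits_integral)
  fix J assume J: "J \<in> T" "s < (\<integral>\<^sup>+y\<in>J. ennreal \<bar>\<phi> y\<bar> \<partial>M) / emeasure M J"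
  have "s * emeasure M J \<le> (\<integral>\<^sup>+y\<in>J. ennreal \<bar>\<phi> y\<bar> \<partial>M) / emeasure M J * emeasure M J"
    using J by (intro mult_right_mono) auto
  also have "\<dots> = (\<integral>\<^sup>+y\<in>J. ennreal \<bar>\<phi> y\<bar> \<partial>M)"
    unfolding ennreal_divide_times using tree_pos[OF J(1)]
    by (subst ennreal_divide_self) (auto simp: emeasure_eq_measure)
  finally show "s * emeasure M J \<le> (\<integral>\<^sup>+y\<in>J. ennreal \<bar>\<phi> y\<bar> \<partial>M)" .
qed measurable

text \<open>If a superlevel set at height s > a had measure at least t, the weak type inequality
  would make its average at least s, against \<open>avg\<close>.\<close>

lemma decr_rearr_maximal_op_le:
  assumes [measurable]: "\<phi> \<in> borel_measurable M" and t: "0 < t" and a: "0 \<le> a"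
    and avg: "\<And>E. E \<in> sets M \<Longrightarrow> t \<le> prob E \<Longrightarrow>
      (\<integral>\<^sup>+x\<in>E. ennreal \<bar>\<phi> x\<bar> \<partial>M) \<le> ennreal (a * prob E)"
  shows "decr_rearr M (maximal_op M T \<phi>) t \<le> ennreal a"
proof (rule decr_rearr_le)
  fix s assume s: "ennreal a < s"
  let ?E = "{x\<in>space M. s < maximal_op M T \<phi> x}"
  show "emeasure M ?E < ennreal t"
  proof (rule ccontr)
    assume "\<not> emeasure M ?E < ennreal t"
    then have le: "t \<le> prob ?E" by (simp add: emeasure_eq_measure not_less)
    have "emeasure M ?E * s \<le> (\<integral>\<^sup>+x\<in>?E. ennreal \<bar>\<phi> x\<bar> \<partial>M)"
      using maximal_op_weak_type by (simp add: mult.commute)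
    also have "\<dots> \<le> ennreal (a * prob ?E)" by (rule avg[OF maximal_op_superlevel_sets le])
    also have "\<dots> = emeasure M ?E * ennreal a"
      using a by (simp add: emeasure_eq_measure ennreal_mult' mult.commute)
    finally have "s \<le> ennreal a"
      using le t by (subst (asm) ennreal_mult_le_mult_iff) (auto simp: emeasure_eq_measure)
    then show False using s by simp
  qed
qed

end

section \<open>Transfer of integrals from the space to the line\<close>

lemma (in prob_space) uniform_on_nn_integral:
  assumes K: "K \<in> sets M" "0 < prob K" and V: "uniform_on M K V b" and b: "0 < b"
    and g[measurable]: "g \<in> borel_measurable borel"
  shows "(\<integral>\<^sup>+x\<in>K. g (V x) \<partial>M) = emeasure M K * ((\<integral>\<^sup>+u\<in>{0<..b}. g u \<partial>lborel) / ennreal b)"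
proof -
  define N where "N = uniform_measure M K"
  interpret N: prob_space N
    unfolding N_def using K by (intro prob_space_uniform_measure) (auto simp: emeasure_eq_measure)
  have Vm[measurable]: "V \<in> borel_measurable M" using V by (simp add: uniform_on_def)
  have spN: "space N = space M" by (simp add: N_def)
  \<comment> \<open>Under the normalised measure on \<open>K\<close> the law of \<open>V\<close> has
    density 1/b on [0, b]; the end point 0 is discarded later as a null set.\<close>
  have "N.prob {x\<in>space N. V x \<le> t} = (t - 0) / (b - 0)" if "0 \<le> t" "t \<le> b" for t
  proof -
    have "N.prob {x\<in>space N. V x \<le> t} = prob (K \<inter> {x\<in>space M. V x \<le> t}) / prob K"
      unfolding spN unfolding N_def using K
      by (intro measure_uniform_measure) (auto simp: emeasure_eq_measure)
    also have "K \<inter> {x\<in>space M. V x \<le> t} = {x\<in>K. V x \<le> t}" using sets.sets_into_space[OF K(1)] by auto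
    finally show ?thesis using V K that b by (simp add: uniform_on_def)
  qed
  then have "distributed N lborel V (\<lambda>x. indicator {0..b} x / measure lborel {0..b})"
    using b by (intro N.uniform_distrI_borel_atLeastAtMost) (auto simp: N_def)
  then have "(\<integral>\<^sup>+x. g (V x) \<partial>N) = (\<integral>\<^sup>+u. ennreal (indicator {0..b} u / b) * g u \<partial>lborel)"
    using b by (subst distributed_nn_integral[symmetric]) auto
  also have "\<dots> = (\<integral>\<^sup>+u. (g u * indicator {0<..b} u) / ennreal b \<partial>lborel)"
  proof (rule nn_integral_cong_AE)
    show "AE u in lborel. ennreal (indicator {0..b} u / b) * g u = g u * indicator {0<..b} u / ennreal b"
      using AE_lborel_singleton[of 0]
    proof eventually_elim
      case (elim u)
      have "ennreal (1 / b) = 1 / ennreal b" using b by (metis divide_ennreal ennreal_1 zero_le_one)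
      then show ?case using elim
        by (auto simp: indicator_def ennreal_divide_times mult.commute ennreal_times_divide)
    qed
  qed
  also have "\<dots> = (\<integral>\<^sup>+u\<in>{0<..b}. g u \<partial>lborel) / ennreal b"
    by (intro nn_integral_divide) measurable
  finally have "(\<integral>\<^sup>+x\<in>K. g (V x) \<partial>M) / emeasure M K = (\<integral>\<^sup>+u\<in>{0<..b}. g u \<partial>lborel) / ennreal b"
    unfolding N_def using K by (subst (asm) nn_integral_uniform_measure) auto
  then have "emeasure M K * ((\<integral>\<^sup>+u\<in>{0<..b}. g u \<partial>lborel) / ennreal b) =
      emeasure M K * ((\<integral>\<^sup>+x\<in>K. g (V x) \<partial>M) / emeasure M K)" by simp
  also have "\<dots> = (\<integral>\<^sup>+x\<in>K. g (V x) \<partial>M)"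
    unfolding ennreal_times_divide using K
    by (subst mult.commute) (auto intro!: mult_divide_eq_ennreal simp: emeasure_eq_measure)
  finally show ?thesis by simp
qed

text \<open>Fubini for the region under the graph. The strict form is used for \<phi> and the
  non-strict one for the envelope, matching what the comparison of level sets yields.\<close>

lemma (in sigma_finite_measure) nn_integral_layer_cake:
  fixes f :: "'a \<Rightarrow> real"
  assumes [measurable]: "f \<in> borel_measurable M"
  shows "(\<integral>\<^sup>+x. ennreal (f x) \<partial>M) = (\<integral>\<^sup>+l\<in>{0<..}. emeasure M {x\<in>space M. l < f x} \<partial>lborel)"
    and "(\<integral>\<^sup>+x. ennreal (f x) \<partial>M) = (\<integral>\<^sup>+l\<in>{0<..}. emeasure M {x\<in>space M. l \<le> f x} \<partial>lborel)"
proof -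
  interpret pair_sigma_finite lborel M ..
  have len: "emeasure lborel {0<..<c} = ennreal c" "emeasure lborel {0<..c} = ennreal c" for c :: real
    by (cases "0 \<le> c"; simp add: ennreal_neg)+
  have "(\<integral>\<^sup>+x. ennreal (f x) \<partial>M) = (\<integral>\<^sup>+x. \<integral>\<^sup>+l. indicator {0<..<f x} l \<partial>lborel \<partial>M)"
    by (simp add: len)
  also have "\<dots> = (\<integral>\<^sup>+x. \<integral>\<^sup>+l. indicator {p\<in>space (lborel \<Otimes>\<^sub>M M). 0 < fst p \<and> fst p < f (snd p)} (l, x) \<partial>lborel \<partial>M)"
    by (intro nn_integral_cong) (auto simp: indicator_def space_pair_measure)
  also have "\<dots> = (\<integral>\<^sup>+l. \<integral>\<^sup>+x. indicator {p\<in>space (lborel \<Otimes>\<^sub>M M). 0 < fst p \<and> fst p < f (snd p)} (l, x) \<partial>M \<partial>lborel)"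
    by (intro Fubini) measurable
  also have "\<dots> = (\<integral>\<^sup>+l. \<integral>\<^sup>+x. indicator {0<..} l * indicator {x\<in>space M. l < f x} x \<partial>M \<partial>lborel)"
    by (intro nn_integral_cong) (auto simp: indicator_def space_pair_measure)
  also have "\<dots> = (\<integral>\<^sup>+l\<in>{0<..}. emeasure M {x\<in>space M. l < f x} \<partial>lborel)"
    by (intro nn_integral_cong) (simp add: nn_integral_cmult mult.commute)
  finally show "(\<integral>\<^sup>+x. ennreal (f x) \<partial>M) = (\<integral>\<^sup>+l\<in>{0<..}. emeasure M {x\<in>space M. l < f x} \<partial>lborel)" .
  have "(\<integral>\<^sup>+x. ennreal (f x) \<partial>M) = (\<integral>\<^sup>+x. \<integral>\<^sup>+l. indicator {0<..f x} l \<partial>lborel \<partial>M)"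
    by (simp add: len)
  also have "\<dots> = (\<integral>\<^sup>+x. \<integral>\<^sup>+l. indicator {p\<in>space (lborel \<Otimes>\<^sub>M M). 0 < fst p \<and> fst p \<le> f (snd p)} (l, x) \<partial>lborel \<partial>M)"
    by (intro nn_integral_cong) (auto simp: indicator_def space_pair_measure)
  also have "\<dots> = (\<integral>\<^sup>+l. \<integral>\<^sup>+x. indicator {p\<in>space (lborel \<Otimes>\<^sub>M M). 0 < fst p \<and> fst p \<le> f (snd p)} (l, x) \<partial>M \<partial>lborel)"
    by (intro Fubini) measurable
  also have "\<dots> = (\<integral>\<^sup>+l. \<integral>\<^sup>+x. indicator {0<..} l * indicator {x\<in>space M. l \<le> f x} x \<partial>M \<partial>lborel)"
    by (intro nn_integral_cong) (auto simp: indicator_def space_pair_measure)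
  also have "\<dots> = (\<integral>\<^sup>+l\<in>{0<..}. emeasure M {x\<in>space M. l \<le> f x} \<partial>lborel)"
    by (intro nn_integral_cong) (simp add: nn_integral_cmult mult.commute)
  finally show "(\<integral>\<^sup>+x. ennreal (f x) \<partial>M) = (\<integral>\<^sup>+l\<in>{0<..}. emeasure M {x\<in>space M. l \<le> f x} \<partial>lborel)" .
qed

text \<open>Let c be the measure of the part of \<open>E\<close> where \<phi> > l. If 0 < u < c and
  \<open>w u < l\<close>, then \<open>less\<close> at t = u would give c < u. Hence (0, c) lies in
  the level set of \<open>w\<close> at height l, and c <= \<open>prob E\<close>; integrating over l
  finishes.\<close>

lemma (in prob_space) nn_integral_le_envelope:
  fixes \<phi> :: "'a \<Rightarrow> real" and w :: "real \<Rightarrow> real"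
  assumes [measurable]: "\<phi> \<in> borel_measurable M" "w \<in> borel_measurable borel"
    and E[measurable]: "E \<in> sets M"
    and less: "\<And>t l. 0 < t \<Longrightarrow> t \<le> 1 \<Longrightarrow> w t < l \<Longrightarrow> 0 < l \<Longrightarrow> prob {x\<in>space M. l < \<phi> x} < t"
  shows "(\<integral>\<^sup>+x\<in>E. ennreal (\<phi> x) \<partial>M) \<le> (\<integral>\<^sup>+u\<in>{0<..prob E}. ennreal (w u) \<partial>lborel)"
proof -
  have "(\<integral>\<^sup>+x\<in>E. ennreal (\<phi> x) \<partial>M) = (\<integral>\<^sup>+x. ennreal (\<phi> x * indicator E x) \<partial>M)"
    by (intro nn_integral_cong) (auto simp: indicator_def)
  also have "\<dots> = (\<integral>\<^sup>+l\<in>{0<..}. emeasure M {x\<in>space M. l < \<phi> x * indicator E x} \<partial>lborel)"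
    by (rule nn_integral_layer_cake) measurable
  also have "\<dots> \<le> (\<integral>\<^sup>+l\<in>{0<..}. emeasure lborel {u\<in>space lborel. l \<le> w u * indicator {0<..prob E} u} \<partial>lborel)"
  proof (intro nn_integral_mono)
    fix l :: real
    let ?A = "{x\<in>space M. l < \<phi> x * indicator E x}"
    show "emeasure M ?A * indicator {0<..} l \<le>
      emeasure lborel {u\<in>space lborel. l \<le> w u * indicator {0<..prob E} u} * indicator {0<..} l"
    proof (cases "0 < l")
      case True
      have AE: "prob ?A \<le> prob E"
        using True by (intro finite_measure_mono) (auto simp: indicator_def split: if_splits)
      have A\<phi>: "prob ?A \<le> prob {x\<in>space M. l < \<phi> x}"
        using True by (intro finite_measure_mono) (auto simp: indicator_def split: if_splits)
      have "l \<le> w u" if "0 < u" "u < prob ?A" for u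
      proof (rule ccontr)
        assume "\<not> l \<le> w u"
        moreover have "u \<le> 1" using that prob_le_1[of ?A] by linarith
        ultimately have "prob {x\<in>space M. l < \<phi> x} < u"
          using that True by (intro less) auto
        then show False using A\<phi> that by simp
      qed
      then have "l \<le> w u * indicator {0<..prob E} u" if "u \<in> {0<..<prob ?A}" for u
        using AE that by (simp add: indicator_def)
      then have "{0<..<prob ?A} \<subseteq> {u\<in>space lborel. l \<le> w u * indicator {0<..prob E} u}"
        by (simp add: subset_eq)
      then have "emeasure lborel {0<..<prob ?A} \<le>
          emeasure lborel {u\<in>space lborel. l \<le> w u * indicator {0<..prob E} u}"
        by (intro emeasure_mono) measurable
      then show ?thesis using True by (simp add: emeasure_eq_measure)
    qed simp
  qed
  also have "\<dots> = (\<integral>\<^sup>+u. ennreal (w u * indicator {0<..prob E} u) \<partial>lborel)"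
    by (rule lborel.nn_integral_layer_cake[symmetric]) measurable
  also have "\<dots> = (\<integral>\<^sup>+u\<in>{0<..prob E}. ennreal (w u) \<partial>lborel)"
    by (intro nn_integral_cong) (auto simp: indicator_def)
  finally show ?thesis .
qed

section \<open>The envelope\<close>

lemma nn_integral_power_profile:
  fixes c q s :: real
  assumes c: "0 < c" and q: "1 < q" and s: "0 < s"
  shows "(\<integral>\<^sup>+u\<in>{0<..s}. ennreal ((c / u) powr (1 / q)) \<partial>lborel) =
    ennreal (c powr (1 / q) * (s powr (1 - 1 / q) / (1 - 1 / q)))"
proof -
  have "((\<lambda>u. u powr (- (1 / q))) has_integral s powr (- (1 / q) + 1) / (- (1 / q) + 1)) {0..s}"
    using q s by (intro has_integral_powr_from_0) auto
  then have "((\<lambda>u. c powr (1 / q) * u powr (- (1 / q))) has_integral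
      c powr (1 / q) * (s powr (- (1 / q) + 1) / (- (1 / q) + 1))) {0..s}"
    by (rule has_integral_mult_right)
  then have "(\<integral>\<^sup>+u. ennreal (indicator {0..s} u * (c powr (1 / q) * u powr (- (1 / q)))) \<partial>lborel) =
      ennreal (c powr (1 / q) * (s powr (- (1 / q) + 1) / (- (1 / q) + 1)))"
    by (intro nn_integral_has_integral_lebesgue) auto
  moreover have "ennreal (indicator {0..s} u * (c powr (1 / q) * u powr (- (1 / q)))) =
      ennreal ((c / u) powr (1 / q)) * indicator {0<..s} u" for u
  proof (cases "0 < u")
    case True
    then have "(c / u) powr (1 / q) = c powr (1 / q) * u powr (- (1 / q))"
      using c by (simp add: powr_divide powr_minus_divide)
    then show ?thesis using True by (auto simp: indicator_def)
  next
    case False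
    then show ?thesis by (cases "u = 0") (auto simp: indicator_def)
  qed
  ultimately show ?thesis by (simp add: algebra_simps)
qed

locale weak_bounds =
  fixes m :: nat and p F :: "nat \<Rightarrow> real"
  assumes m: "1 \<le> m" and F_pos: "\<And>j. j \<in> {1..m} \<Longrightarrow> 0 < F j"
    and p_gt_1: "\<And>j. j \<in> {1..m} \<Longrightarrow> 1 < p j"
begin

abbreviation "w \<equiv> weak_envelope m p F"
abbreviation "\<Psi> \<equiv> envelope_integral m p F"

lemma index_ne: "{1..m} \<noteq> {}" "finite {1..m}" using m by auto

lemma envelope_le: "j \<in> {1..m} \<Longrightarrow> w u \<le> (F j / u) powr (1 / p j)"
  unfolding weak_envelope_def by (intro Min_le) auto

lemma envelope_attained: "\<exists>j\<in>{1..m}. w u = (F j / u) powr (1 / p j)"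
proof -
  have "w u \<in> (\<lambda>j. (F j / u) powr (1 / p j)) ` {1..m}"
    unfolding weak_envelope_def using index_ne by (intro Min_in) auto
  then show ?thesis by blast
qed

lemma envelope_pos: "0 < u \<Longrightarrow> 0 < w u"
  using envelope_attained[of u] F_pos by force

lemma envelope_nonneg: "0 \<le> w u"
  using envelope_attained[of u] by (metis powr_ge_zero)

lemma envelope_antimono:
  assumes "0 < u" "u \<le> v"
  shows "w v \<le> w u"
proof -
  obtain j where j: "j \<in> {1..m}" "w u = (F j / u) powr (1 / p j)" using envelope_attained by blast
  have "w v \<le> (F j / v) powr (1 / p j)" by (rule envelope_le[OF j(1)])
  also have "\<dots> \<le> (F j / u) powr (1 / p j)"
    using assms F_pos[OF j(1)] p_gt_1[OF j(1)] by (intro powr_mono2 divide_left_mono) auto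
  finally show ?thesis using j(2) by simp
qed

lemma envelope_measurable [measurable]: "w \<in> borel_measurable borel"
  unfolding weak_envelope_def by measurable

lemma envelope_integral_finite: "(\<integral>\<^sup>+u\<in>{0<..s}. ennreal (w u) \<partial>lborel) < \<infinity>"
proof (cases "0 < s")
  case True
  have 1: "1 \<in> {1..m}" using m by simp
  have "(\<integral>\<^sup>+u\<in>{0<..s}. ennreal (w u) \<partial>lborel) \<le>
      (\<integral>\<^sup>+u\<in>{0<..s}. ennreal ((F 1 / u) powr (1 / p 1)) \<partial>lborel)"
    using envelope_le[OF 1] by (intro nn_integral_mono mult_right_mono ennreal_leI) auto
  also have "\<dots> < \<infinity>"
    using nn_integral_power_profile[OF F_pos[OF 1] p_gt_1[OF 1] True] by simp
  finally show ?thesis .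
qed simp

lemma envelope_integral_nn: "ennreal (\<Psi> s) = (\<integral>\<^sup>+u\<in>{0<..s}. ennreal (w u) \<partial>lborel)"
proof -
  have "\<Psi> s = (\<integral>u. indicator {0<..s} u * w u \<partial>lborel)"
    unfolding envelope_integral_def set_lebesgue_integral_def by (subst integral_completion) auto
  also have "\<dots> = enn2real (\<integral>\<^sup>+u. ennreal (indicator {0<..s} u * w u) \<partial>lborel)"
    using envelope_nonneg by (intro integral_eq_nn_integral) auto
  also have "(\<integral>\<^sup>+u. ennreal (indicator {0<..s} u * w u) \<partial>lborel) =
      (\<integral>\<^sup>+u\<in>{0<..s}. ennreal (w u) \<partial>lborel)"
    by (intro nn_integral_cong) (auto simp: indicator_def)
  finally show ?thesis using envelope_integral_finite[of s] by simp
qed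

lemma envelope_integral_nonneg: "0 \<le> \<Psi> s"
  unfolding envelope_integral_def set_lebesgue_integral_def
  using envelope_nonneg by (intro integral_nonneg_AE) auto

lemma envelope_integral_0 [simp]: "\<Psi> 0 = 0"
  by (simp add: envelope_integral_def set_lebesgue_integral_def)

lemma envelope_integral_add:
  assumes "0 \<le> a" "a \<le> b"
  shows "ennreal (\<Psi> b) = ennreal (\<Psi> a) + (\<integral>\<^sup>+u\<in>{a<..b}. ennreal (w u) \<partial>lborel)"
proof -
  have "ennreal (w u) * indicator {0<..b} u =
      ennreal (w u) * indicator {0<..a} u + ennreal (w u) * indicator {a<..b} u" for u
    using assms by (auto simp: indicator_def)
  then show ?thesis unfolding envelope_integral_nn by (simp add: nn_integral_add)
qed

text \<open>On (a, b] the decreasing envelope is at least \<open>w b\<close>. The case a = 0 is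
  included, as it compares \<open>b * w b\<close> with the whole integral.\<close>

lemma envelope_integral_lower:
  assumes "0 \<le> a" "a \<le> b" "0 < b"
  shows "\<Psi> a + (b - a) * w b \<le> \<Psi> b"
proof -
  have "ennreal ((b - a) * w b) = (\<integral>\<^sup>+u. ennreal (w b) * indicator {a<..b} u \<partial>lborel)"
    using assms envelope_nonneg
    by (subst nn_integral_cmult_indicator) (simp_all add: ennreal_mult' mult.commute)
  also have "\<dots> \<le> (\<integral>\<^sup>+u\<in>{a<..b}. ennreal (w u) \<partial>lborel)"
    using assms by (intro nn_integral_mono)
      (auto simp: indicator_def intro!: ennreal_leI envelope_antimono)
  finally have "ennreal (\<Psi> a) + ennreal ((b - a) * w b) \<le> ennreal (\<Psi> b)"
    unfolding envelope_integral_add[OF assms(1,2)] by (rule add_left_mono)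
  then show ?thesis
    using assms envelope_nonneg envelope_integral_nonneg
    by (simp flip: ennreal_plus)
qed

lemma envelope_integral_upper:
  assumes "0 < a" "a \<le> b"
  shows "\<Psi> b \<le> \<Psi> a + (b - a) * w a"
proof -
  have "(\<integral>\<^sup>+u\<in>{a<..b}. ennreal (w u) \<partial>lborel) \<le> (\<integral>\<^sup>+u. ennreal (w a) * indicator {a<..b} u \<partial>lborel)"
    using assms by (intro nn_integral_mono)
      (auto simp: indicator_def intro!: ennreal_leI envelope_antimono)
  also have "\<dots> = ennreal ((b - a) * w a)"
    using assms envelope_nonneg
    by (subst nn_integral_cmult_indicator) (simp_all add: ennreal_mult' mult.commute)
  finally have "ennreal (\<Psi> b) \<le> ennreal (\<Psi> a) + ennreal ((b - a) * w a)"
    using assms envelope_integral_add[of a b] by (simp add: add_left_mono)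
  then show ?thesis
    using assms envelope_nonneg envelope_integral_nonneg
    by (simp flip: ennreal_plus)
qed

lemma envelope_integral_strict_mono:
  assumes "0 \<le> a" "a < b"
  shows "\<Psi> a < \<Psi> b"
proof -
  have "0 < (b - a) * w b" using assms envelope_pos[of b] by simp
  then show ?thesis using envelope_integral_lower[of a b] assms by simp
qed

lemma envelope_integral_mono: "0 \<le> a \<Longrightarrow> a \<le> b \<Longrightarrow> \<Psi> a \<le> \<Psi> b"
  using envelope_integral_strict_mono[of a b] by (cases "a = b") auto

lemma envelope_integral_le_power:
  assumes j: "j \<in> {1..m}" and s: "0 < s"
  shows "\<Psi> s \<le> F j powr (1 / p j) * (s powr (1 - 1 / p j) / (1 - 1 / p j))"
proof -
  have "ennreal (\<Psi> s) \<le> (\<integral>\<^sup>+u\<in>{0<..s}. ennreal ((F j / u) powr (1 / p j)) \<partial>lborel)"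
    unfolding envelope_integral_nn
    using envelope_le[OF j] by (intro nn_integral_mono mult_right_mono ennreal_leI) auto
  then show ?thesis
    using nn_integral_power_profile[OF F_pos[OF j] p_gt_1[OF j] s] F_pos[OF j] p_gt_1[OF j] by simp
qed

text \<open>Away from the singularity at 0 the integrand is at most \<open>w a\<close>, which serves
  as a Lipschitz constant.\<close>

lemma envelope_integral_continuous:
  assumes "0 < a"
  shows "continuous_on {a..b} \<Psi>"
proof -
  have "(w a)-lipschitz_on {a..b} \<Psi>"
  proof (rule lipschitz_on_leI)
    fix x y assume xy: "x \<in> {a..b}" "y \<in> {a..b}" "x \<le> y"
    have "\<Psi> y - \<Psi> x \<le> (y - x) * w x" using envelope_integral_upper[of x y] xy assms by simp
    also have "\<dots> \<le> (y - x) * w a" using envelope_antimono[of a x] xy assms by (intro mult_left_mono) auto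
    finally show "dist (\<Psi> x) (\<Psi> y) \<le> w a * dist x y"
      using envelope_integral_mono[of x y] xy assms by (simp add: dist_real_def mult.commute)
  qed (rule envelope_nonneg)
  then show ?thesis by (rule lipschitz_on_continuous_on)
qed

section \<open>Existence and uniqueness of the cut-off \<sigma>\<close>

lemma envelope_integral_small:
  assumes "0 < f"
  shows "\<exists>s>0. \<Psi> s < f"
proof -
  have 1: "1 \<in> {1..m}" using m by simp
  define c q where "c = F 1 powr (1 / p 1) / (1 - 1 / p 1)" and "q = 1 - 1 / p 1"
  have q: "0 < q" using p_gt_1[OF 1] by (simp add: q_def)
  have "((\<lambda>s. c * s powr q) \<longlongrightarrow> c * 0) (at_right 0)"
    using q by (intro tendsto_intros tendsto_zero_powrI[where b=q])
      (auto simp: eventually_at_filter tendsto_ident_at)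
  then have "eventually (\<lambda>s. c * s powr q < f) (at_right 0)"
    using assms by (intro order_tendstoD) auto
  then have "eventually (\<lambda>s. c * s powr q < f \<and> 0 < s) (at_right 0)"
    using eventually_at_right_less[of "0::real"] by eventually_elim simp
  then obtain s where s: "c * s powr q < f" "0 < s"
    using eventually_happens'[of "at_right (0::real)"] by (auto simp: trivial_limit_at_right_real)
  then show ?thesis
    using envelope_integral_le_power[OF 1 s(2)] by (auto simp: c_def q_def)
qed

text \<open>Unboundedness of the integral, as for the harmonic series: for u >= 1 the exponents
  1/p_j < 1 give \<open>w u\<close> >= c/u, so each dyadic block contributes at least c/2.\<close>

lemma envelope_integral_doubling: "\<exists>c>0. \<forall>n. real n * c \<le> \<Psi> (2 ^ n)"
proof -
  define c where "c = Min ((\<lambda>j. F j powr (1 / p j)) ` {1..m})"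
  have c: "0 < c" unfolding c_def using index_ne F_pos by (subst Min_gr_iff) force+
  have w_ge: "c / u \<le> w u" if u: "1 \<le> u" for u
  proof -
    obtain j where j: "j \<in> {1..m}" "w u = (F j / u) powr (1 / p j)" using envelope_attained by blast
    have "u powr (1 / p j) \<le> u powr 1"
      using u p_gt_1[OF j(1)] by (intro powr_mono) auto
    then have "F j powr (1 / p j) / u \<le> F j powr (1 / p j) / u powr (1 / p j)"
      using u F_pos[OF j(1)] by (intro divide_left_mono) auto
    also have "\<dots> = w u" using u j F_pos[OF j(1)] by (simp add: powr_divide)
    finally have "F j powr (1 / p j) / u \<le> w u" .
    moreover have "c \<le> F j powr (1 / p j)" unfolding c_def using j by (intro Min_le) auto
    then have "c / u \<le> F j powr (1 / p j) / u" using u by (intro divide_right_mono) auto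
    ultimately show ?thesis by simp
  qed
  have "real n * (c / 2) \<le> \<Psi> (2 ^ n)" for n
  proof (induction n)
    case 0 then show ?case by (simp add: envelope_integral_nonneg)
  next
    case (Suc n)
    have "c / 2 = (2 ^ Suc n - 2 ^ n) * (c / 2 ^ Suc n)" by simp
    also have "\<dots> \<le> (2 ^ Suc n - 2 ^ n) * w (2 ^ Suc n)"
      by (intro mult_left_mono w_ge one_le_power) auto
    also have "\<dots> \<le> \<Psi> (2 ^ Suc n) - \<Psi> (2 ^ n)"
      using envelope_integral_lower[of "2 ^ n" "2 ^ Suc n"] by simp
    finally show ?case using Suc by (simp add: algebra_simps)
  qed
  then show ?thesis using c by (intro exI[of _ "c / 2"]) auto
qed

text \<open>Continuity is available only away from 0, so the intermediate value theorem starts at a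
  small positive point where the integral is still below f. Strict monotonicity gives
  uniqueness.\<close>

lemma ex1_envelope_integral_eq:
  assumes f: "0 < f"
  shows "\<exists>!\<sigma>. 0 < \<sigma> \<and> \<Psi> \<sigma> = f"
proof (rule ex_ex1I)
  obtain a where a: "0 < a" "\<Psi> a < f" using envelope_integral_small[OF f] by blast
  obtain c where c: "0 < c" "\<And>n. real n * c \<le> \<Psi> (2 ^ n)" using envelope_integral_doubling by blast
  obtain n where "f < real n * c" using reals_Archimedean3[OF c(1)] by blast
  then have n: "f \<le> \<Psi> (2 ^ n)" using c(2)[of n] by simp
  have "a \<le> 2 ^ n"
    using n a envelope_integral_mono[of "2 ^ n" a] by (cases "a \<le> 2 ^ n") auto
  then obtain s where "a \<le> s" "\<Psi> s = f"
    using IVT'[of \<Psi> a f "2 ^ n"] a n envelope_integral_continuous by auto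
  then show "\<exists>\<sigma>. 0 < \<sigma> \<and> \<Psi> \<sigma> = f" using a by (intro exI[of _ s]) auto
next
  fix x y assume "0 < x \<and> \<Psi> x = f" "0 < y \<and> \<Psi> y = f"
  then show "x = y"
    using envelope_integral_strict_mono[of x y] envelope_integral_strict_mono[of y x]
    by (cases x y rule: linorder_cases) auto
qed

text \<open>Averages of a decreasing function over initial segments decrease; beyond \<sigma> the
  numerator is constant and only the denominator grows.\<close>

lemma envelope_average_antimono:
  assumes \<sigma>: "0 < \<sigma>" and t: "0 < t" "t \<le> t'"
  shows "\<Psi> (min t' \<sigma>) / t' \<le> \<Psi> (min t \<sigma>) / t"
proof -
  have avg: "\<Psi> b / b \<le> \<Psi> a / a" if ab: "0 < a" "a \<le> b" for a b
  proof -
    \<comment> \<open>Division is avoided by multiplying with a; the next step uses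
      \<open>a * w a\<close> <= \<Psi> a.\<close>
    have "a * \<Psi> b \<le> a * \<Psi> a + (b - a) * (a * w a)"
      using mult_left_mono[OF envelope_integral_upper[OF ab], of a] ab by (simp add: algebra_simps)
    also have "\<dots> \<le> a * \<Psi> a + (b - a) * \<Psi> a"
      using envelope_integral_lower[of 0 a] ab by (intro add_left_mono mult_left_mono) auto
    finally show ?thesis using ab by (simp add: field_simps)
  qed
  show ?thesis
  proof (cases "t \<le> \<sigma>")
    case True
    have "\<Psi> (min t' \<sigma>) / t' \<le> \<Psi> (min t' \<sigma>) / min t' \<sigma>"
      using t \<sigma> envelope_integral_nonneg by (intro divide_left_mono) auto
    also have "\<dots> \<le> \<Psi> t / t" using t True by (intro avg) auto
    finally show ?thesis using True by (simp add: min_absorb1)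
  next
    case False
    then show ?thesis using t envelope_integral_nonneg by (auto intro!: divide_left_mono)
  qed
qed

text \<open>For one bound, \<Psi> 1 equals F^(1/p) p/(p-1). As p/(p-1) >= 1, this is at least (F
  p/(p-1))^(1/p), hence at least \<Psi> \<sigma>. For several bounds the integral of the minimum can
  be smaller than every single integral, so the argument fails and the theorem assumes \<sigma> <= 1
  there: if \<sigma> > 1, every function obeying the weak bounds has integral at most \<Psi> 1 < f,
  so none is admissible.\<close>

lemma endpoint_le_1:
  assumes "m = 1" "0 < \<sigma>" "\<Psi> \<sigma> \<le> (p 1 / (p 1 - 1) * F 1) powr (1 / p 1)"
  shows "\<sigma> \<le> 1"
proof (rule ccontr)
  assume "\<not> \<sigma> \<le> 1"
  have p: "1 < p 1" and F: "0 < F 1" using assms(1) p_gt_1 F_pos by auto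
  have "ennreal (\<Psi> 1) = (\<integral>\<^sup>+u\<in>{0<..1}. ennreal ((F 1 / u) powr (1 / p 1)) \<partial>lborel)"
    using envelope_integral_nn[of 1] by (simp add: weak_envelope_def assms(1))
  also have "\<dots> = ennreal (F 1 powr (1 / p 1) * (1 / (1 - 1 / p 1)))"
    using nn_integral_power_profile[OF F p, of 1] by simp
  finally have "\<Psi> 1 = F 1 powr (1 / p 1) * (1 / (1 - 1 / p 1))"
    using envelope_integral_nonneg p by simp
  also have "1 / (1 - 1 / p 1) = p 1 / (p 1 - 1)" using p by (simp add: field_simps)
  finally have "\<Psi> 1 = F 1 powr (1 / p 1) * (p 1 / (p 1 - 1))" .
  moreover have "(p 1 / (p 1 - 1)) powr (1 / p 1) \<le> (p 1 / (p 1 - 1)) powr 1"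
    using p by (intro powr_mono) auto
  then have "F 1 powr (1 / p 1) * (p 1 / (p 1 - 1)) powr (1 / p 1) \<le>
      F 1 powr (1 / p 1) * (p 1 / (p 1 - 1))"
    using p by (intro mult_left_mono) auto
  moreover have "(p 1 / (p 1 - 1) * F 1) powr (1 / p 1) =
      F 1 powr (1 / p 1) * (p 1 / (p 1 - 1)) powr (1 / p 1)"
    using p F by (subst powr_mult) auto
  ultimately have "(p 1 / (p 1 - 1) * F 1) powr (1 / p 1) \<le> \<Psi> 1" by simp
  moreover have "\<Psi> 1 < \<Psi> \<sigma>"
    using \<open>\<not> \<sigma> \<le> 1\<close> by (intro envelope_integral_strict_mono) auto
  ultimately show False using assms(3) by simp
qed

end

section \<open>The Bellman function\<close>

locale weak_bellman = measure_tree M T C + weak_bounds m p F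
  for M :: "'a measure" and T :: "'a set set" and C :: "'a set \<Rightarrow> 'a set set"
    and m :: nat and p F :: "nat \<Rightarrow> real" +
  fixes f \<sigma> :: real
  assumes sigma_pos: "0 < \<sigma>" and sigma_le_1: "\<sigma> \<le> 1" and envelope_integral_sigma: "\<Psi> \<sigma> = f"
begin

text \<open>The function A of the overview.\<close>

definition optimal_average :: "real \<Rightarrow> real" where
  "optimal_average t = 1 / t * \<Psi> (min t \<sigma>)"

lemma optimal_average_antimono:
  "0 < t \<Longrightarrow> t \<le> t' \<Longrightarrow> optimal_average t' \<le> optimal_average t"
  using envelope_average_antimono[OF sigma_pos] by (simp add: optimal_average_def)

lemma optimal_average_nonneg: "0 < t \<Longrightarrow> 0 \<le> optimal_average t"
  unfolding optimal_average_def using envelope_integral_nonneg by simp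

text \<open>Only the weak bound whose index attains the minimum at this particular t is used; that
  index varies with t.\<close>

lemma admissible_superlevel:
  assumes \<phi>: "\<phi> \<in> admissible M m p F f" and t: "0 < t" "t \<le> 1" and l: "w t < l" "0 < l"
  shows "prob {x\<in>space M. l < \<phi> x} < t"
proof -
  have [measurable]: "\<phi> \<in> borel_measurable M" using \<phi> by (simp add: admissible_def)
  obtain j where j: "j \<in> {1..m}" "w t = (F j / t) powr (1 / p j)" using envelope_attained by blast
  let ?d = "decr_rearr M (\<lambda>x. ennreal \<bar>\<phi> x\<bar>) t"
  define N where "N = enn2real (weak_norm M (p j) \<phi>)"
  have N: "weak_norm M (p j) \<phi> = ennreal N" "N powr p j \<le> F j" "0 \<le> N"
    using \<phi> j by (auto simp: admissible_def N_def)
  have "(N powr p j) powr (1 / p j) \<le> F j powr (1 / p j)"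
    using N p_gt_1[OF j(1)] by (intro powr_mono2) auto
  then have N_le: "N \<le> F j powr (1 / p j)"
    using N p_gt_1[OF j(1)] by (simp add: powr_powr)
  have "ennreal (t powr (1 / p j)) * ?d \<le> ennreal N"
    unfolding N(1)[symmetric] weak_norm_def using t by (intro SUP_upper) auto
  also have "\<dots> \<le> ennreal (F j powr (1 / p j))" using N_le by (rule ennreal_leI)
  also have "\<dots> = ennreal (t powr (1 / p j)) * ennreal (w t)"
    unfolding j(2) using t F_pos[OF j(1)] by (simp add: powr_divide flip: ennreal_mult')
  finally have "?d \<le> ennreal (w t)"
    using t by (subst (asm) ennreal_mult_le_mult_iff) auto
  also have "\<dots> < ennreal l" using l by (simp add: ennreal_lessI)
  finally have "emeasure M {x\<in>space M. ennreal l < ennreal \<bar>\<phi> x\<bar>} < ennreal t"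
    by (rule measure_superlevel_less) measurable
  then have "prob {x\<in>space M. ennreal l < ennreal \<bar>\<phi> x\<bar>} < t"
    by (simp add: emeasure_eq_measure ennreal_less_iff)
  moreover have "prob {x\<in>space M. l < \<phi> x} \<le> prob {x\<in>space M. ennreal l < ennreal \<bar>\<phi> x\<bar>}"
    using l by (intro finite_measure_mono) (auto simp: ennreal_less_iff)
  ultimately show ?thesis by simp
qed

text \<open>Over a set \<open>E\<close> the mass of \<phi> is limited twice: by the total f = \<Psi>
  \<sigma> and by the envelope, \<Psi> (\<open>prob E\<close>). Monotonicity of \<Psi> merges both
  into the value at the minimum, and monotonicity of the averages passes from \<open>prob E\<close>
  to t.\<close>

lemma admissible_decr_rearr_le:
  assumes \<phi>: "\<phi> \<in> admissible M m p F f" and t: "0 < t"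
  shows "decr_rearr M (maximal_op M T \<phi>) t \<le> ennreal (optimal_average t)"
proof (rule decr_rearr_maximal_op_le)
  show \<phi>m[measurable]: "\<phi> \<in> borel_measurable M" using \<phi> by (simp add: admissible_def)
  have nonneg: "0 \<le> \<phi> x" if "x \<in> space M" for x using \<phi> that by (simp add: admissible_def)
  have int: "integrable M \<phi>" "(\<integral>x. \<bar>\<phi> x\<bar> \<partial>M) = f" using \<phi> by (auto simp: admissible_def)
  fix E assume E: "E \<in> sets M" "t \<le> prob E"
  have Esp: "E \<subseteq> space M" using E sets.sets_into_space by blast
  have "(\<integral>\<^sup>+x\<in>E. ennreal \<bar>\<phi> x\<bar> \<partial>M) \<le> (\<integral>\<^sup>+x. ennreal \<bar>\<phi> x\<bar> \<partial>M)"
    by (intro nn_integral_mono) (auto simp: indicator_def)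
  also have "\<dots> = ennreal f"
    using int by (subst nn_integral_eq_integral) auto
  finally have 1: "(\<integral>\<^sup>+x\<in>E. ennreal \<bar>\<phi> x\<bar> \<partial>M) \<le> ennreal (\<Psi> \<sigma>)"
    unfolding envelope_integral_sigma .
  have "(\<integral>\<^sup>+x\<in>E. ennreal \<bar>\<phi> x\<bar> \<partial>M) = (\<integral>\<^sup>+x\<in>E. ennreal (\<phi> x) \<partial>M)"
    using nonneg by (intro nn_integral_cong) auto
  also have "\<dots> \<le> (\<integral>\<^sup>+u\<in>{0<..prob E}. ennreal (w u) \<partial>lborel)"
    using admissible_superlevel[OF \<phi>] E by (intro nn_integral_le_envelope) auto
  finally have 2: "(\<integral>\<^sup>+x\<in>E. ennreal \<bar>\<phi> x\<bar> \<partial>M) \<le> ennreal (\<Psi> (prob E))"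
    unfolding envelope_integral_nn .
  have "(\<integral>\<^sup>+x\<in>E. ennreal \<bar>\<phi> x\<bar> \<partial>M) \<le> ennreal (\<Psi> (min (prob E) \<sigma>))"
    using 1 2 by (cases "prob E \<le> \<sigma>") (auto simp: min_def)
  also have "\<Psi> (min (prob E) \<sigma>) = optimal_average (prob E) * prob E"
    using E t by (simp add: optimal_average_def)
  also have "\<dots> \<le> optimal_average t * prob E"
    using optimal_average_antimono[OF t E(2)] by (intro mult_right_mono) auto
  finally show "(\<integral>\<^sup>+x\<in>E. ennreal \<bar>\<phi> x\<bar> \<partial>M) \<le> ennreal (optimal_average t * prob E)"
    by (simp add: ennreal_leI)
qed (use t optimal_average_nonneg in auto)

text \<open>The parameter e has two roles, as the defect of the ratio r = 1 - e and as the smallest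
  t considered, so a single limit removes both losses.\<close>

lemma near_optimal:
  assumes e: "0 < e" "e < 1"
  shows "\<exists>\<phi>\<in>admissible M m p F f. \<forall>t. e \<le> t \<and> t \<le> 1 \<longrightarrow>
    ennreal (optimal_average (t / (1 - e))) \<le> decr_rearr M (maximal_op M T \<phi>) t"
proof -
  define r where "r = 1 - e"
  have r: "0 < r" "r < 1" using e by (auto simp: r_def)
  \<comment> \<open>This depth puts a prepared scale below every t >= e.\<close>
  obtain N where N: "r ^ N < e" using real_arch_pow_inv[OF e(1) r(2)] by blast
  obtain V where V: "uniform_on M (space M) V 1"
    and tower: "\<And>j. j \<le> N \<Longrightarrow>
      r ^ j * prob (space M) \<le> prob (\<Union>{K\<in>T. K \<subseteq> space M \<and> uniform_on M K V (r ^ j)})"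
    using uniform_tower[OF r root_in_tree, of N] by blast
  have Vm[measurable]: "V \<in> borel_measurable M" using V by (simp add: uniform_on_def)
  define g where "g u = w u * indicator {0<..\<sigma>} u" for u
  have g[measurable]: "g \<in> borel_measurable borel" unfolding g_def by measurable
  have g_nonneg: "0 \<le> g u" for u using envelope_nonneg by (simp add: g_def)
  define \<phi> where "\<phi> x = g (V x)" for x
  have \<phi>m[measurable]: "\<phi> \<in> borel_measurable M" unfolding \<phi>_def by measurable
  have g_integral: "(\<integral>\<^sup>+u\<in>{0<..b}. ennreal (g u) \<partial>lborel) = ennreal (\<Psi> (min b \<sigma>))" for b
    unfolding envelope_integral_nn
    by (intro nn_integral_cong) (auto simp: g_def indicator_def)
  have \<phi>_nn: "(\<integral>\<^sup>+x\<in>K. ennreal (\<phi> x) \<partial>M) = emeasure M K * ennreal (optimal_average b)"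
    if "K \<in> T" "uniform_on M K V b" "0 < b" for K b
    unfolding \<phi>_def using that tree_pos sets_tree envelope_integral_nonneg
    by (subst uniform_on_nn_integral[where b=b])
      (auto simp: g_integral optimal_average_def divide_ennreal)
  have "(\<integral>\<^sup>+x. ennreal (\<phi> x) \<partial>M) = (\<integral>\<^sup>+x\<in>space M. ennreal (\<phi> x) \<partial>M)"
    by (intro nn_integral_cong) auto
  also have "\<dots> = ennreal f"
    using \<phi>_nn[OF root_in_tree V] envelope_integral_sigma sigma_le_1
    by (simp add: emeasure_space_1 optimal_average_def)
  finally have \<phi>_f: "(\<integral>\<^sup>+x. ennreal (\<phi> x) \<partial>M) = ennreal f" .
  have f: "0 \<le> f" using envelope_integral_sigma envelope_integral_nonneg by metis
  have \<phi>_nonneg: "0 \<le> \<phi> x" for x using g_nonneg by (simp add: \<phi>_def)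
  have int: "integrable M \<phi>" using \<phi>_f \<phi>_nonneg by (intro integrableI_nonneg) auto
  have int_f: "(\<integral>x. \<bar>\<phi> x\<bar> \<partial>M) = f"
    using \<phi>_nonneg \<phi>_f f by (subst integral_eq_nn_integral) auto
  have weak: "weak_norm M (p j) \<phi> \<le> ennreal (F j powr (1 / p j))" if j: "j \<in> {1..m}" for j
    unfolding weak_norm_def
  proof (rule SUP_least)
    fix t :: real assume t: "t \<in> {0<..1}"
    have pj: "1 < p j" "0 < F j" using j p_gt_1 F_pos by auto
    have "decr_rearr M (\<lambda>x. ennreal \<bar>\<phi> x\<bar>) t \<le> ennreal ((F j / t) powr (1 / p j))"
    proof (rule decr_rearr_le)
      fix s assume s: "ennreal ((F j / t) powr (1 / p j)) < s"
      show "emeasure M {x\<in>space M. s < ennreal \<bar>\<phi> x\<bar>} < ennreal t"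
      proof (cases s)
        case top then show ?thesis using t by simp
      next
        case (real l)
        have lt: "(F j / t) powr (1 / p j) < l" using s real by (simp add: ennreal_less_iff)
        have l: "0 < l" by (rule le_less_trans[OF _ lt]) simp
        have "((F j / t) powr (1 / p j)) powr p j < l powr p j"
          using lt pj by (intro powr_less_mono2) auto
        then have less: "F j / l powr p j < t"
          using pj t l by (simp add: powr_powr field_simps)
        \<comment> \<open>Superlevel sets of \<phi> lie in initial segments of \<open>V\<close>. By
          \<open>less\<close> the segment ends before t <= 1, where the distribution function of
          \<open>V\<close> is the identity.\<close>
        have "V x \<le> F j / l powr p j" if "l < \<phi> x" for x
        proof -
          have Vx: "0 < V x" "l < w (V x)"
            using that l by (cases "V x \<in> {0<..\<sigma>}"; simp add: \<phi>_def g_def)+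
          have "l powr p j < ((F j / V x) powr (1 / p j)) powr p j"
            using Vx l pj envelope_le[OF j, of "V x"] by (intro powr_less_mono2) auto
          then have "l powr p j < F j / V x" using pj Vx by (simp add: powr_powr)
          then show ?thesis using Vx l by (simp add: field_simps)
        qed
        then have "emeasure M {x\<in>space M. s < ennreal \<bar>\<phi> x\<bar>} \<le>
            emeasure M {x\<in>space M. V x \<le> F j / l powr p j}"
          using real \<phi>_nonneg by (intro emeasure_mono) (auto simp: ennreal_less_iff)
        also have "\<dots> = ennreal (F j / l powr p j)"
          using V less t pj by (simp add: emeasure_eq_measure uniform_on_def prob_space)
        also have "\<dots> < ennreal t" using less t by (simp add: ennreal_lessI)
        finally show ?thesis .
      qed
    qed
    then have "ennreal (t powr (1 / p j)) * decr_rearr M (\<lambda>x. ennreal \<bar>\<phi> x\<bar>) t \<le>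
        ennreal (t powr (1 / p j)) * ennreal ((F j / t) powr (1 / p j))"
      by (intro mult_left_mono) auto
    also have "\<dots> = ennreal (F j powr (1 / p j))"
      using t pj by (simp add: powr_divide flip: ennreal_mult')
    finally show "ennreal (t powr (1 / p j)) * decr_rearr M (\<lambda>x. ennreal \<bar>\<phi> x\<bar>) t \<le>
        ennreal (F j powr (1 / p j))" .
  qed
  have "weak_norm M (p j) \<phi> < \<infinity> \<and> enn2real (weak_norm M (p j) \<phi>) powr p j \<le> F j"
    if j: "j \<in> {1..m}" for j
  proof
    show fin: "weak_norm M (p j) \<phi> < \<infinity>"
      using weak[OF j] by (rule le_less_trans) simp
    have "enn2real (weak_norm M (p j) \<phi>) \<le> F j powr (1 / p j)"
      using weak[OF j] by (intro enn2real_leI) auto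
    then have "enn2real (weak_norm M (p j) \<phi>) powr p j \<le> (F j powr (1 / p j)) powr p j"
      using p_gt_1[OF j] by (intro powr_mono2) auto
    then show "enn2real (weak_norm M (p j) \<phi>) powr p j \<le> F j"
      using p_gt_1[OF j] F_pos[OF j] by (simp add: powr_powr)
  qed
  then have adm: "\<phi> \<in> admissible M m p F f"
    unfolding admissible_def using \<phi>_nonneg int int_f by auto
  have "ennreal (optimal_average (t / (1 - e))) \<le> decr_rearr M (maximal_op M T \<phi>) t"
    if t: "e \<le> t" "t \<le> 1" for t
  proof -
    have ex: "r ^ N < t" using N t by simp
    \<comment> \<open>The last scale not below t: \<open>r ^ Suc j\<close> < t <=
      \<open>r ^ j\<close>. The least exponent is positive because \<open>r ^ 0\<close> = 1 >= t, so
      subtracting one is harmless.\<close>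
    define j where "j = (LEAST j. r ^ j < t) - 1"
    have L: "r ^ (LEAST j. r ^ j < t) < t" using ex by (rule LeastI)
    have "(LEAST j. r ^ j < t) \<noteq> 0" using L t by (auto intro: ccontr)
    then have Suc: "(LEAST j. r ^ j < t) = Suc j" by (simp add: j_def)
    have "Suc j \<le> N" using ex Suc by (metis Least_le)
    then have j: "j \<le> N" by simp
    have less: "r ^ Suc j < t" using L Suc by simp
    have "\<not> r ^ j < t" using not_less_Least[of j "\<lambda>j. r ^ j < t"] Suc by simp
    then have le: "t \<le> r ^ j" by simp
    let ?b = "r ^ j"
    let ?E = "\<Union>{K\<in>T. K \<subseteq> space M \<and> uniform_on M K V ?b}"
    have "ennreal (optimal_average ?b) \<le> maximal_op M T \<phi> x" if "x \<in> ?E" for x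
    proof -
      obtain K where K: "K \<in> T" "uniform_on M K V ?b" "x \<in> K" using \<open>x \<in> ?E\<close> by blast
      have "ennreal (optimal_average ?b) = ennreal (optimal_average ?b) * emeasure M K / emeasure M K"
        using tree_pos[OF K(1)]
        by (intro mult_divide_eq_ennreal[symmetric]) (auto simp: emeasure_eq_measure)
      also have "\<dots> = (\<integral>\<^sup>+y\<in>K. ennreal \<bar>\<phi> y\<bar> \<partial>M) / emeasure M K"
        using \<phi>_nn[OF K(1,2)] r \<phi>_nonneg by (simp add: mult.commute)
      also have "\<dots> \<le> maximal_op M T \<phi> x"
        unfolding maximal_op_def using K by (intro SUP_upper) auto
      finally show ?thesis .
    qed
    then have sub: "?E \<subseteq> {x\<in>space M. ennreal (optimal_average ?b) \<le> maximal_op M T \<phi> x}"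
      by blast
    have "t \<le> prob ?E" using tower[OF j] le by (simp add: prob_space)
    then have tE: "ennreal t \<le> emeasure M ?E" by (simp add: emeasure_eq_measure ennreal_leI)
    \<comment> \<open>Neighbouring scales differ by the factor r, so rounding t up to a scale loses
      at most this factor.\<close>
    have "?b \<le> t / (1 - e)" using less r by (simp add: r_def[symmetric] field_simps)
    then have "optimal_average (t / (1 - e)) \<le> optimal_average ?b"
      using r by (intro optimal_average_antimono) auto
    then have "ennreal (optimal_average (t / (1 - e))) \<le> ennreal (optimal_average ?b)"
      by (rule ennreal_leI)
    also have "\<dots> \<le> decr_rearr M (maximal_op M T \<phi>) t"
      by (rule le_decr_rearr[OF sub tE maximal_op_superlevel_sets])
    finally show ?thesis .
  qed
  then show ?thesis using adm by blast
qed

section \<open>The weighted integrals: upper bound and passage to the limit\<close>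

context
  fixes G h :: "real \<Rightarrow> real" and k :: real
  assumes G_mono: "mono_on {0..} G" and G_nonneg: "\<forall>x\<ge>0. 0 \<le> G x"
    and h_nonneg: "\<forall>t\<in>{0<..1}. 0 \<le> h t" and h_int: "locally_integrable_01 h"
    and k: "0 < k" "k \<le> 1"
begin

lemma bellman_le:
  "bellman M T G h m p F f k \<le> (\<integral>\<^sup>+t\<in>{0<..k}. ennreal (G (optimal_average t) * h t) \<partial>lebesgue)"
  unfolding bellman_def
proof (rule SUP_least, rule nn_integral_mono)
  fix \<phi> and t :: real assume \<phi>: "\<phi> \<in> admissible M m p F f"
  show "ennreal (G (enn2real (decr_rearr M (maximal_op M T \<phi>) t)) * h t) * indicator {0<..k} t \<le>
      ennreal (G (optimal_average t) * h t) * indicator {0<..k} t"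
  proof (cases "t \<in> {0<..k}")
    case True
    then have "enn2real (decr_rearr M (maximal_op M T \<phi>) t) \<le> optimal_average t"
      using admissible_decr_rearr_le[OF \<phi>] optimal_average_nonneg by (intro enn2real_leI) auto
    then have "G (enn2real (decr_rearr M (maximal_op M T \<phi>) t)) \<le> G (optimal_average t)"
      using True optimal_average_nonneg by (intro mono_onD[OF G_mono]) auto
    then show ?thesis using True h_nonneg k by (auto intro!: ennreal_leI mult_right_mono)
  qed simp
qed

text \<open>Local integrability controls \<open>h\<close> only on compact subsets of (0, 1]; the
  intervals [1/(n+1), 1] exhaust it, and pointwise limits stay measurable. Fatou's lemma needs
  this.\<close>

lemma weight_measurable: "(\<lambda>t. indicator {0<..1} t * h t) \<in> borel_measurable lebesgue"
proof (rule borel_measurable_LIMSEQ_real)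
  fix n :: nat
  have "0 < t" if "1 / real (Suc n) \<le> t" for t
    by (rule less_le_trans[OF _ that]) simp
  then have "{1 / real (Suc n)..1} \<subseteq> {0<..1}" by auto
  then have "set_integrable lebesgue {1 / real (Suc n)..1} h"
    using h_int compact_Icc unfolding locally_integrable_01_def by blast
  then show "(\<lambda>t. indicator {1 / real (Suc n)..1} t * h t) \<in> borel_measurable lebesgue"
    unfolding set_integrable_def by (auto dest: borel_measurable_integrable)
next
  fix t :: real
  show "(\<lambda>n. indicator {1 / real (Suc n)..1} t * h t) \<longlonglongrightarrow> indicator {0<..1} t * h t"
  proof (cases "0 < t")
    case True
    then have "eventually (\<lambda>n. 1 / real (Suc n) < t) sequentially"
      using order_tendstoD(2)[OF LIMSEQ_inverse_real_of_nat] by (simp add: inverse_eq_divide)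
    then have "eventually (\<lambda>n. indicator {1 / real (Suc n)..1} t * h t = indicator {0<..1} t * h t) sequentially"
      by eventually_elim (use True in \<open>auto simp: indicator_def\<close>)
    then show ?thesis by (rule tendsto_eventually)
  next
    case False
    have "0 < 1 / real (Suc n)" for n by simp
    then have "\<not> 1 / real (Suc n) \<le> t" for n using False by (meson le_less_trans less_le_trans)
    then show ?thesis using False by (simp add: indicator_def)
  qed
qed

lemma le_bellman:
  "(\<integral>\<^sup>+t\<in>{0<..k}. ennreal (G (optimal_average t) * h t) \<partial>lebesgue) \<le> bellman M T G h m p F f k"
proof -
  define B where "B t = G (optimal_average t)" for t
  \<comment> \<open>The sign turns a decreasing function into an increasing one, the form in which
    both measurability and countability of the discontinuities are available.\<close>
  have B_anti: "mono_on {0<..} (\<lambda>t. - B t)"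
    using optimal_average_antimono optimal_average_nonneg
    by (auto simp: mono_on_def B_def intro!: mono_onD[OF G_mono])
  have B_nonneg: "0 \<le> B t" if "0 < t" for t
    using G_nonneg optimal_average_nonneg[OF that] by (simp add: B_def)
  have B_meas[measurable]: "(\<lambda>t. indicator {0<..} t * B t) \<in> borel_measurable borel"
  proof -
    have "(\<lambda>t. - B t) \<in> borel_measurable (restrict_space borel {0<..})"
      by (rule borel_measurable_mono_on_fnc[OF B_anti])
    then have "(\<lambda>t. indicator {0<..} t *\<^sub>R (- B t)) \<in> borel_measurable borel"
      by (subst (asm) borel_measurable_restrict_space_iff) (auto simp: mult.commute)
    then have "(\<lambda>t. - (indicator {0<..} t *\<^sub>R (- B t))) \<in> borel_measurable borel"
      by (rule borel_measurable_uminus)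
    then show ?thesis by simp
  qed
  \<comment> \<open>The shift by two keeps \<open>e n\<close> < 1 already at n = 0.\<close>
  define e where "e n = inverse (real (Suc (Suc n)))" for n
  have e: "0 < e n" "e n < 1" for n by (auto simp: e_def field_simps)
  have e0: "e \<longlonglongrightarrow> 0" unfolding e_def by (rule LIMSEQ_Suc[OF LIMSEQ_inverse_real_of_nat])
  \<comment> \<open>A minorant of the integrand of the n-th near-optimal function. It vanishes below
    \<open>e n\<close>, where \<open>near_optimal\<close> gives no information.\<close>
  define q where "q n t = ennreal (B (t / (1 - e n)) * h t) * indicator {e n..k} t" for n t
  \<comment> \<open>\<open>B\<close> and \<open>h\<close> are controlled only on (0, \<infinity>)
    and (0, 1]; the indicators make each factor measurable on the whole line without changing
    \<open>q\<close>.\<close>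
  have q_eq: "q n t = ennreal ((indicator {0<..} (t / (1 - e n)) * B (t / (1 - e n))) *
      (indicator {0<..1} t * h t)) * indicator {e n..k} t" for n t
    using e[of n] k by (auto simp: q_def indicator_def)
  have "(\<lambda>t. indicator {0<..} (t / (1 - e n)) * B (t / (1 - e n))) \<in> borel_measurable lebesgue" for n
    by (rule measurable_completion, rule measurable_compose[OF _ B_meas]) measurable
  then have qh: "(\<lambda>t. (indicator {0<..} (t / (1 - e n)) * B (t / (1 - e n))) *
      (indicator {0<..1} t * h t)) \<in> borel_measurable lebesgue" for n
    by (rule borel_measurable_times[OF _ weight_measurable])
  have q_meas: "q n \<in> borel_measurable lebesgue" for n
    unfolding q_eq[abs_def]
    by (intro borel_measurable_times_ennreal borel_measurable_indicator
      measurable_compose[OF qh measurable_ennreal]) auto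
  have q_le: "(\<integral>\<^sup>+t. q n t \<partial>lebesgue) \<le> bellman M T G h m p F f k" for n
  proof -
    obtain \<phi> where \<phi>: "\<phi> \<in> admissible M m p F f"
      and opt: "\<And>t. e n \<le> t \<Longrightarrow> t \<le> 1 \<Longrightarrow>
        ennreal (optimal_average (t / (1 - e n))) \<le> decr_rearr M (maximal_op M T \<phi>) t"
      using near_optimal[OF e[of n]] by blast
    have "(\<integral>\<^sup>+t. q n t \<partial>lebesgue) \<le>
      (\<integral>\<^sup>+t\<in>{0<..k}. ennreal (G (enn2real (decr_rearr M (maximal_op M T \<phi>) t)) * h t) \<partial>lebesgue)"
    proof (rule nn_integral_mono)
      fix t
      show "q n t \<le> ennreal (G (enn2real (decr_rearr M (maximal_op M T \<phi>) t)) * h t) * indicator {0<..k} t"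
      proof (cases "t \<in> {e n..k}")
        case True
        then have t: "0 < t" "t \<le> 1" using e[of n] k by auto
        let ?d = "decr_rearr M (maximal_op M T \<phi>) t"
        have fin: "?d < \<infinity>"
          using admissible_decr_rearr_le[OF \<phi> t(1)] by (rule le_less_trans) simp
        have A0: "0 \<le> optimal_average (t / (1 - e n))"
          using t e[of n] by (intro optimal_average_nonneg) auto
        have "ennreal (optimal_average (t / (1 - e n))) \<le> ennreal (enn2real ?d)"
          using opt[of t] True t fin by simp
        then have "optimal_average (t / (1 - e n)) \<le> enn2real ?d" by simp
        then have "B (t / (1 - e n)) \<le> G (enn2real ?d)"
          unfolding B_def using A0 by (intro mono_onD[OF G_mono]) auto
        then show ?thesis
          using True t h_nonneg by (auto simp: q_def intro!: ennreal_leI mult_right_mono)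
      qed (simp add: q_def)
    qed
    also have "\<dots> \<le> bellman M T G h m p F f k"
      unfolding bellman_def using \<phi> by (rule SUP_upper)
    finally show ?thesis .
  qed
  have cnt: "countable {t\<in>{0<..}. \<not> isCont (\<lambda>t. - B t) t}"
    by (rule mono_on_ctble_discont_open[OF _ B_anti]) simp
  have "AE t in lebesgue. ennreal (B t * h t) * indicator {0<..k} t = liminf (\<lambda>n. q n t)"
    using AE_completion[OF AE_not_in[OF countable_imp_null_set_lborel[OF cnt]]]
  proof eventually_elim
    case (elim t)
    have "(\<lambda>n. q n t) \<longlonglongrightarrow> ennreal (B t * h t) * indicator {0<..k} t"
    proof (cases "t \<in> {0<..k}")
      case True
      then have "isCont (\<lambda>t. - B t) t" using elim by auto
      then have cont: "isCont B t" using continuous_minus[of "at t" "\<lambda>t. - B t"] by simp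
      have "(\<lambda>n. t / (1 - e n)) \<longlonglongrightarrow> t / (1 - 0)" by (intro tendsto_intros e0) simp
      then have "(\<lambda>n. B (t / (1 - e n))) \<longlonglongrightarrow> B t"
        using isCont_tendsto_compose[OF cont] by simp
      then have lim: "(\<lambda>n. ennreal (B (t / (1 - e n)) * h t)) \<longlonglongrightarrow> ennreal (B t * h t)"
        by (intro tendsto_intros)
      have "eventually (\<lambda>n. e n < t) sequentially"
        using order_tendstoD(2)[OF e0] True by simp
      then have "eventually (\<lambda>n. q n t = ennreal (B (t / (1 - e n)) * h t)) sequentially"
        by eventually_elim (use True in \<open>auto simp: q_def\<close>)
      then show ?thesis using lim True by (simp add: tendsto_cong)
    next
      case False
      then have "q n t = 0" for n using e[of n] by (auto simp: q_def indicator_def)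
      then show ?thesis using False by simp
    qed
    then show ?case by (simp add: lim_imp_Liminf)
  qed
  then have "(\<integral>\<^sup>+t\<in>{0<..k}. ennreal (B t * h t) \<partial>lebesgue) = (\<integral>\<^sup>+t. liminf (\<lambda>n. q n t) \<partial>lebesgue)"
    by (rule nn_integral_cong_AE)
  also have "\<dots> \<le> liminf (\<lambda>n. \<integral>\<^sup>+t. q n t \<partial>lebesgue)"
    by (rule nn_integral_liminf[OF q_meas])
  also have "\<dots> \<le> bellman M T G h m p F f k"
    using q_le by (intro Liminf_le) auto
  finally show ?thesis by (simp add: B_def)
qed

lemma bellman_eq:
  "bellman M T G h m p F f k = (\<integral>\<^sup>+t\<in>{0<..k}. ennreal (G (optimal_average t) * h t) \<partial>lebesgue)"
  by (rule antisym[OF bellman_le le_bellman])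

end

end

lemma is_tree_imp_measure_tree:
  assumes "prob_space M" "is_tree M T"
  shows "\<exists>C. measure_tree M T C"
proof -
  interpret prob_space M by fact
  have T: "T \<subseteq> sets M" "space M \<in> T" "\<forall>I\<in>T. 0 < emeasure M I"
    using assms(2) by (simp_all add: is_tree_def)
  obtain C where C: "\<forall>I\<in>T. C I \<subseteq> T \<and> finite (C I) \<and> 2 \<le> card (C I) \<and> (\<forall>J\<in>C I. J \<subseteq> I) \<and>
      pairwise (\<lambda>A B. emeasure M (A \<inter> B) = 0) (C I) \<and> I = \<Union>(C I)"
    and lev: "T = (\<Union>n. tree_level C (space M) n)"
      "(\<lambda>n. SUP I\<in>tree_level C (space M) n. emeasure M I) \<longlonglongrightarrow> 0"
    using assms(2) unfolding is_tree_def by (elim conjE exE)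
  have "measure_tree M T C"
  proof
    fix I assume I: "I \<in> T"
    show "C I \<subseteq> T" "finite (C I)" "\<Union>(C I) = I"
      using bspec[OF C I] by simp_all
    show "0 < prob I" using T(3) I by (simp add: emeasure_eq_measure)
    have "pairwise (\<lambda>A B. emeasure M (A \<inter> B) = 0) (C I)" "C I \<subseteq> sets M"
      using bspec[OF C I] T(1) by (blast, blast)
    then show "pairwise (\<lambda>A B. A \<inter> B \<in> null_sets M) (C I)"
      by (auto simp: pairwise_def null_sets_def)
  qed (fact T(1) T(2) lev)+
  then show ?thesis by blast
qed

theorem theorem2:
  fixes M :: "'a measure" and T :: "'a set set"
    and m :: nat and p F :: "nat \<Rightarrow> real" and f k :: real
    and G h :: "real \<Rightarrow> real"
  assumes "prob_space M" and "nonatomic M" and "is_tree M T"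
    and "1 \<le> m" and "0 < f"
    and "\<forall>j\<in>{1..m}. 0 < F j" and "\<forall>j\<in>{1..m}. 1 < p j"
    and "f \<le> (MIN j\<in>{1..m}. (p j / (p j - 1) * F j) powr (1 / p j))"
    and "mono_on {0..} G" and "\<forall>x\<ge>0. 0 \<le> G x"
    and "\<forall>t\<in>{0<..1}. 0 \<le> h t" and "locally_integrable_01 h"
    and "0 < k" and "k \<le> 1"
  shows "(\<exists>!\<sigma>. 0 < \<sigma> \<and> envelope_integral m p F \<sigma> = f) \<and>
    (\<forall>\<sigma>. 0 < \<sigma> \<and> envelope_integral m p F \<sigma> = f \<and> (2 \<le> m \<longrightarrow> \<sigma> \<le> 1) \<longrightarrow>
       bellman M T G h m p F f k =
         (\<integral>\<^sup>+t\<in>{0<..k}. ennreal (G (1 / t * envelope_integral m p F (min t \<sigma>)) * h t) \<partial>lebesgue))"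
proof (intro conjI allI impI)
  interpret weak_bounds m p F by standard (use assms in auto)
  show "\<exists>!\<sigma>. 0 < \<sigma> \<and> envelope_integral m p F \<sigma> = f"
    using assms by (intro ex1_envelope_integral_eq)
  fix \<sigma> assume \<sigma>: "0 < \<sigma> \<and> envelope_integral m p F \<sigma> = f \<and> (2 \<le> m \<longrightarrow> \<sigma> \<le> 1)"
  have "\<sigma> \<le> 1"
  proof (cases "m = 1")
    case True
    then show ?thesis using assms(8) \<sigma> by (intro endpoint_le_1) auto
  qed (use \<sigma> assms(4) in auto)
  obtain C where "measure_tree M T C" using is_tree_imp_measure_tree assms(1,3) by blast
  then interpret measure_tree M T C .
  interpret weak_bellman M T C m p F f \<sigma>
    by standard (use \<sigma> \<open>\<sigma> \<le> 1\<close> in auto)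
  show "bellman M T G h m p F f k =
      (\<integral>\<^sup>+t\<in>{0<..k}. ennreal (G (1 / t * envelope_integral m p F (min t \<sigma>)) * h t) \<partial>lebesgue)"
    using bellman_eq[OF assms(9-14)] by (simp add: optimal_average_def)
qed

end
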